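(* The Maximum Matching Edge Interdiction problem (MMEI), restricted to bipartite input graphs in which all edge weights and all interdiction costs equal $1$, is fixed-parameter tractable when parameterized by $m$.
   Context: For an edge-weighted graph $G$, $\nu(G)$ denotes the maximum total weight of a matching in $G$. For $I\subseteq E$, $G-I$ is the graph obtained by deleting the edges of $I$, and $c(I)=\sum_{e\in I}c(e)$. MMEI: given an undirected graph $G=(V,E)$ with weight function $w:E\to\mathbb{Z}_{\ge 0}$, interdiction cost function $c:E\to\mathbb{Z}_{\ge 1}$, and positive integers $b$ and $m$, decide whether there is a set $I\subseteq E$ with $c(I)\le b$ such that $\nu(G-I)\le m$. *)

theory Defs
  imports "HOL-Library.Log_Nat" "HOL-Library.Disjoint_Sets"
begin

subsection \<open>Random access machines\<close>

text \<open>
  The machine has registers and an addressable memory, both indexed by and holding natural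
  numbers. Its control structure is given by while programs, which simulate programs with jumps,
  and are simulated by them, with a constant-factor overhead for each fixed program.
  The time measure is unit cost. There is no multiplication, so a step makes the longest stored
  number longer by at most one bit. Running times on this machine and on Turing machines are
  therefore polynomially related.
\<close>

datatype prog =
    Skip
  | Const nat nat
  | Add nat nat nat
  | Sub nat nat nat
  | Load nat nat
  | Store nat nat
  | Seq prog prog
  | IfNZ nat prog prog
  | WhileNZ nat prog

type_synonym config = "(nat \<Rightarrow> nat) \<times> (nat \<Rightarrow> nat)"

text \<open>\<open>exec p s t s'\<close>: started in configuration \<open>s\<close>, the program \<open>p\<close> halts after exactly \<open>t\<close> steps
  in configuration \<open>s'\<close>. Subtraction is truncated at \<open>0\<close>.\<close>

inductive exec :: "prog \<Rightarrow> config \<Rightarrow> nat \<Rightarrow> config \<Rightarrow> bool" where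
  Skip: "exec Skip s 1 s"
| Const: "exec (Const i n) (r, h) 1 (r(i := n), h)"
| Add: "exec (Add i j k) (r, h) 1 (r(i := r j + r k), h)"
| Sub: "exec (Sub i j k) (r, h) 1 (r(i := r j - r k), h)"
| Load: "exec (Load i j) (r, h) 1 (r(i := h (r j)), h)"
| Store: "exec (Store i j) (r, h) 1 (r, h(r i := r j))"
| Seq: "exec p s t s' \<Longrightarrow> exec q s' u s'' \<Longrightarrow> exec (Seq p q) s (t + u) s''"
| IfTrue: "fst s i \<noteq> 0 \<Longrightarrow> exec p s t s' \<Longrightarrow> exec (IfNZ i p q) s (1 + t) s'"
| IfFalse: "fst s i = 0 \<Longrightarrow> exec q s t s' \<Longrightarrow> exec (IfNZ i p q) s (1 + t) s'"
| WhileTrue: "fst s i \<noteq> 0 \<Longrightarrow> exec p s t s' \<Longrightarrow> exec (WhileNZ i p) s' u s''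
    \<Longrightarrow> exec (WhileNZ i p) s (1 + t + u) s''"
| WhileFalse: "fst s i = 0 \<Longrightarrow> exec (WhileNZ i p) s 1 s"

text \<open>The input is stored in the memory cells \<open>0, 1, \<dots>\<close> and its length in register \<open>0\<close>.
  The result is read off register \<open>0\<close>.\<close>

definition initial_config :: "nat list \<Rightarrow> config" where
  "initial_config ws =
     ((\<lambda>_. 0)(0 := length ws), \<lambda>a. if a < length ws then ws ! a else 0)"

definition computes_within :: "prog \<Rightarrow> nat list \<Rightarrow> nat \<Rightarrow> nat \<Rightarrow> bool" where
  "computes_within p ws T y \<longleftrightarrow>
     (\<exists>t s. exec p (initial_config ws) t s \<and> t \<le> T \<and> fst s 0 = y)"

definition computable :: "(nat \<Rightarrow> nat) \<Rightarrow> bool" where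
  "computable f \<longleftrightarrow> (\<exists>p. \<forall>k. \<exists>T. computes_within p [k] T (f k))"


subsection \<open>Fixed-parameter tractability\<close>

text \<open>Size of an input word in bits, where \<open>floorlog 2 x\<close> is the length of the binary
  representation of \<open>x\<close> (and \<open>0\<close> for \<open>x = 0\<close>) and the summand \<open>1\<close> accounts for a separator.\<close>

definition input_size :: "nat list \<Rightarrow> nat" where
  "input_size ws = (\<Sum>x\<leftarrow>ws. floorlog 2 x + 1)"

text \<open>A decision problem consists of a set \<open>I\<close> of instances and the property \<open>yes\<close> to be decided;
  \<open>encodes x ws\<close> means that the word \<open>ws\<close> is an encoding of the instance \<open>x\<close>, and \<open>\<kappa> x\<close> is the
  parameter. There has to be a single program, correct on every encoding of every instance,
  with running time \<open>f (\<kappa> x)\<close> times a power of the input size, for a computable function \<open>f\<close>.\<close>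

definition fixed_parameter_tractable ::
  "('i \<Rightarrow> nat list \<Rightarrow> bool) \<Rightarrow> 'i set \<Rightarrow> ('i \<Rightarrow> bool) \<Rightarrow> ('i \<Rightarrow> nat) \<Rightarrow> bool" where
  "fixed_parameter_tractable encodes I yes \<kappa> \<longleftrightarrow>
     (\<exists>p f d. computable f \<and>
        (\<forall>x\<in>I. \<forall>ws. encodes x ws \<longrightarrow>
           computes_within p ws (f (\<kappa> x) * (input_size ws + 1) ^ d) (if yes x then 1 else 0)))"


subsection \<open>Maximum Matching Edge Interdiction\<close>

definition simple_graph :: "'a set \<Rightarrow> 'a set set \<Rightarrow> bool" where
  "simple_graph V E \<longleftrightarrow> finite V \<and> (\<forall>e\<in>E. e \<subseteq> V \<and> card e = 2)"

definition bipartite :: "'a set \<Rightarrow> 'a set set \<Rightarrow> bool" where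
  "bipartite V E \<longleftrightarrow>
     (\<exists>A B. A \<union> B = V \<and> A \<inter> B = {} \<and> (\<forall>e\<in>E. \<exists>a\<in>A. \<exists>b\<in>B. e = {a, b}))"

definition matching :: "'a set set \<Rightarrow> 'a set set \<Rightarrow> bool" where
  "matching E M \<longleftrightarrow> M \<subseteq> E \<and> disjoint M"

definition max_matching_weight :: "'a set set \<Rightarrow> ('a set \<Rightarrow> nat) \<Rightarrow> nat" where
  "max_matching_weight E w = Max {\<Sum>e\<in>M. w e | M. matching E M}"

record mmei =
  verts :: "nat set"
  edges :: "nat set set"
  weight :: "nat set \<Rightarrow> nat"
  cost :: "nat set \<Rightarrow> nat"
  budget :: nat
  bound :: nat

definition mmei_instance :: "mmei \<Rightarrow> bool" where
  "mmei_instance x \<longleftrightarrow> simple_graph (verts x) (edges x) \<and> (\<forall>e\<in>edges x. cost x e \<ge> 1) \<and>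
     budget x \<ge> 1 \<and> bound x \<ge> 1"

definition mmei_yes :: "mmei \<Rightarrow> bool" where
  "mmei_yes x \<longleftrightarrow>
     (\<exists>I\<subseteq>edges x. (\<Sum>e\<in>I. cost x e) \<le> budget x \<and>
        max_matching_weight (edges x - I) (weight x) \<le> bound x)"

text \<open>An instance is encoded by the numbers of vertices and edges and the two numbers \<open>b\<close> and \<open>m\<close>,
  followed by the list of vertices and the list of edges with their weights and costs.
  The order of either list, and of the two endpoints of an edge, is arbitrary.\<close>

definition mmei_encodes :: "mmei \<Rightarrow> nat list \<Rightarrow> bool" where
  "mmei_encodes x ws \<longleftrightarrow>
     (\<exists>vs es. distinct vs \<and> set vs = verts x \<and>
        distinct (map (\<lambda>(u, v). {u, v}) es) \<and> set (map (\<lambda>(u, v). {u, v}) es) = edges x \<and>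
        ws = [length vs, length es, budget x, bound x] @ vs @
          concat (map (\<lambda>(u, v). [u, v, weight x {u, v}, cost x {u, v}]) es))"

lemma mmei_encoding_exists:
  assumes "mmei_instance x"
  shows "\<exists>ws. mmei_encodes x ws"
proof -
  let ?S = "\<lambda>(u, v). {u, v} :: nat set"
  have fin: "finite (verts x)" and E: "\<forall>e\<in>edges x. e \<subseteq> verts x \<and> card e = 2"
    using assms by (auto simp: mmei_instance_def simple_graph_def)
  then have "edges x \<subseteq> Pow (verts x)" by auto
  with fin have "finite (edges x)" by (meson finite_Pow_iff finite_subset)
  then obtain es' where es': "set es' = edges x" "distinct es'"
    using finite_distinct_list by blast
  obtain vs where vs: "set vs = verts x" "distinct vs"
    using fin finite_distinct_list by blast
  have "\<forall>e\<in>edges x. \<exists>q. ?S q = e"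
    using E by (metis case_prod_conv card_2_iff)
  then obtain g where g: "\<forall>e\<in>edges x. ?S (g e) = e" by metis
  have *: "map ?S (map g es') = es'"
    unfolding map_map by (rule map_idI) (use g es'(1) in auto)
  show ?thesis
    unfolding mmei_encodes_def
    apply (rule exI, rule exI[of _ vs], rule exI[of _ "map g es'"])
    using vs es' * by (intro conjI; simp only:)
qed

definition unit_bipartite_mmei :: "mmei set" where
  "unit_bipartite_mmei =
     {x. mmei_instance x \<and> bipartite (verts x) (edges x) \<and>
         (\<forall>e\<in>edges x. weight x e = 1 \<and> cost x e = 1)}"

end

theory Submission
  imports Defs
begin

text \<open>By Koenig's theorem, an instance is a yes-instance iff some set of at most \<open>m\<close> vertices leaves at
  most \<open>b\<close> edges uncovered. Such a set is found by branching: always take or finally reject the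
  undecided vertex that covers the most uncovered edges. If a solution avoids the next \<open>2 k\<close> such
  vertices, where \<open>k\<close> vertices may still be taken, then \<open>k\<close> of those lie in one part of the graph;
  being independent, they cover at least as much as the solution. Hence some solution takes one of
  them, and \<open>2 m + 2 (m - 1) + \<dots> = m (m + 1)\<close> decisions suffice. The program runs through all
  decision sequences of this length, read off the binary digits of a counter.\<close>

section \<open>Interdiction and partial vertex covers\<close>

text \<open>A vertex set costs nothing and the edges that it misses are the ones to delete, so the
  task is a partial vertex cover problem. The obstacle is that neither the degrees nor
  \<open>b\<close> are bounded in terms of \<open>m\<close>, and that a vertex of largest degree
  need not lie in any solution, because the edges gained from different vertices may overlap. Within
  one part of the graph they never do. Rejecting a vertex leaves all residual degrees unchanged, so
  consecutive rejections run through the undecided vertices by decreasing degree. The exchange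
  replaces the rest of a solution as a whole, and everything it brings in is still undecided. Hence
  rejections can be final although the solution aimed at may change on the way. Since all decision
  sequences have the same length, a counter stands in for recursion: every run restarts from
  scratch, and no stack has to be modelled.\<close>

definition uncovered :: "'a set set \<Rightarrow> 'a set \<Rightarrow> 'a set set" where
  "uncovered E S = {e \<in> E. e \<inter> S = {}}"

lemma finite_uncovered [simp]: "finite E \<Longrightarrow> finite (uncovered E S)"
  by (simp add: uncovered_def)

text \<open>If \<open>xy\<^sub>1\<close> and \<open>xy\<^sub>2\<close> are distinct edges and \<open>C\<^sub>1\<close>, \<open>C\<^sub>2\<close> cover all edges but the respective
  one, then uncrossing \<open>C\<^sub>1\<close> and \<open>C\<^sub>2\<close> (union on one side and intersection on the other) gives
  two sets of total size at most \<open>2 m\<close>, of which one is a cover and the other becomes one after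
  adding \<open>x\<close>.\<close>

lemma edge_minimal_matching:
  assumes AB: "A \<inter> B = {}" and E: "\<forall>e\<in>E. \<exists>a\<in>A. \<exists>b\<in>B. e = {a, b}"
    and no: "\<And>C. finite C \<Longrightarrow> uncovered E C = {} \<Longrightarrow> m < card C"
    and crit: "\<And>e. e \<in> E \<Longrightarrow> \<exists>C. finite C \<and> card C \<le> m \<and> uncovered (E - {e}) C = {}"
  shows "disjoint E"
proof (rule ccontr)
  assume "\<not> disjoint E"
  then obtain e1 e2 x where e: "e1 \<in> E" "e2 \<in> E" "e1 \<noteq> e2" "x \<in> e1" "x \<in> e2"
    by (auto simp: disjoint_def)
  \<comment> \<open>The common endpoint may lie in either part. The contradiction is therefore
    derived for arbitrary parts and used again with \<open>A\<close> and \<open>B\<close>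
    exchanged.\<close>
  have goal: False
    if AB: "A \<inter> B = {}" and E: "\<And>e. e \<in> E \<Longrightarrow> \<exists>a\<in>A. \<exists>b\<in>B. e = {a, b}" and xA: "x \<in> A"
    for A B
  proof -
    obtain y1 where y1: "e1 = {x, y1}" "y1 \<in> B"
      using E[OF e(1)] e(4) AB xA by auto
    obtain y2 where y2: "e2 = {x, y2}" "y2 \<in> B"
      using E[OF e(2)] e(5) AB xA by auto
    obtain C1 where C1: "finite C1" "card C1 \<le> m" "uncovered (E - {e1}) C1 = {}"
      using crit[OF e(1)] by blast
    obtain C2 where C2: "finite C2" "card C2 \<le> m" "uncovered (E - {e2}) C2 = {}"
      using crit[OF e(2)] by blast
    have n1: "x \<notin> C1"
    proof
      assume "x \<in> C1"
      then have "uncovered E C1 = {}" using C1(3) y1 by (auto simp: uncovered_def)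
      then show False using no[OF C1(1)] C1(2) by simp
    qed
    have n2: "x \<notin> C2"
    proof
      assume "x \<in> C2"
      then have "uncovered E C2 = {}" using C2(3) y2 by (auto simp: uncovered_def)
      then show False using no[OF C2(1)] C2(2) by simp
    qed
    have m1: "y2 \<in> C1" using C1(3) e n1 y2 by (auto simp: uncovered_def)
    have m2: "y1 \<in> C2" using C2(3) e n2 y1 by (auto simp: uncovered_def)
    let ?A1 = "C1 \<inter> A" let ?A2 = "C2 \<inter> A" let ?B1 = "C1 \<inter> B" let ?B2 = "C2 \<inter> B"
    let ?U = "(?A1 \<inter> ?A2) \<union> (?B1 \<union> ?B2)"
    let ?W = "(?A1 \<union> ?A2) \<union> (?B1 \<inter> ?B2)"
    have fin: "finite ?A1" "finite ?A2" "finite ?B1" "finite ?B2" using C1 C2 by auto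
    \<comment> \<open>Let \<open>{a, b}\<close> be any other edge. Either both covers contain
      \<open>a\<close> or one of them contains \<open>b\<close>, so \<open>?U\<close> meets it; with
      the ends exchanged, so does \<open>?W\<close>.\<close>
    have cov: "e \<inter> C1 \<noteq> {} \<and> e \<inter> C2 \<noteq> {}" if "e \<in> E" "e \<noteq> e1" "e \<noteq> e2" for e
      using C1(3) C2(3) that by (auto simp: uncovered_def)
    have "uncovered E ?U = {}"
    proof -
      have "e \<inter> ?U \<noteq> {}" if eE: "e \<in> E" for e
      proof (cases "e = e1 \<or> e = e2")
        case True
        moreover have "y1 \<in> e1 \<inter> ?U" "y2 \<in> e2 \<inter> ?U" using y1 y2 m1 m2 by auto
        ultimately show ?thesis by blast
      next
        case False
        obtain a b where "a \<in> A" "b \<in> B" "e = {a, b}" using E[OF eE] by auto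
        then show ?thesis using cov[OF eE] False by blast
      qed
      then show ?thesis by (auto simp: uncovered_def)
    qed
    moreover have "uncovered E (insert x ?W) = {}"
    proof -
      have "e \<inter> insert x ?W \<noteq> {}" if eE: "e \<in> E" for e
      proof (cases "e = e1 \<or> e = e2")
        case True
        then show ?thesis using e(4,5) by blast
      next
        case False
        obtain a b where "a \<in> A" "b \<in> B" "e = {a, b}" using E[OF eE] by auto
        then show ?thesis using cov[OF eE] False by blast
      qed
      then show ?thesis by (auto simp: uncovered_def)
    qed
    ultimately have U: "m < card ?U" and W: "m < card (insert x ?W)"
      using no fin by (meson finite_Int finite_Un finite_insert)+
    have "card (insert x ?W) \<le> Suc (card ?W)" by (rule card_insert_le_m1) auto
    then have W': "m \<le> card ?W" using W by simp
    have d: "?A1 \<inter> ?B1 = {}" "?A2 \<inter> ?B2 = {}" using AB by auto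
    have "card ?U = card (?A1 \<inter> ?A2) + card (?B1 \<union> ?B2)"
      by (rule card_Un_disjoint) (use fin AB in auto)
    moreover have "card ?W = card (?A1 \<union> ?A2) + card (?B1 \<inter> ?B2)"
      by (rule card_Un_disjoint) (use fin AB in auto)
    moreover have "card ?A1 + card ?A2 = card (?A1 \<union> ?A2) + card (?A1 \<inter> ?A2)"
      by (rule card_Un_Int) (use fin in auto)
    moreover have "card ?B1 + card ?B2 = card (?B1 \<union> ?B2) + card (?B1 \<inter> ?B2)"
      by (rule card_Un_Int) (use fin in auto)
    moreover have "card ?A1 + card ?B1 \<le> card C1"
      using card_Un_disjoint[OF fin(1,3) d(1)] card_mono[OF C1(1), of "?A1 \<union> ?B1"] by auto
    moreover have "card ?A2 + card ?B2 \<le> card C2"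
      using card_Un_disjoint[OF fin(2,4) d(2)] card_mono[OF C2(1), of "?A2 \<union> ?B2"] by auto
    ultimately show False using U W' C1(2) C2(2) by linarith
  qed
  have E': "\<exists>a\<in>A. \<exists>b\<in>B. e = {a, b}" if "e \<in> E" for e
    using E that by (rule bspec)
  obtain a b where "a \<in> A" "b \<in> B" "e1 = {a, b}" using E'[OF e(1)] by auto
  then have "x \<in> A \<or> x \<in> B" using e(4) by auto
  then show False
  proof
    assume "x \<in> A"
    with AB E' show False by (rule goal)
  next
    assume xB: "x \<in> B"
    have "B \<inter> A = {}" using AB by blast
    then show False
    proof (rule goal)
      fix e assume "e \<in> E"
      then obtain a b where "a \<in> A" "b \<in> B" "e = {a, b}" using E' by blast
      then show "\<exists>a\<in>B. \<exists>b\<in>A. e = {a, b}" by (metis insert_commute)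
    qed (rule xB)
  qed
qed

text \<open>An edge set that is minimal among those without a cover of size at most \<open>m\<close>
  is a matching, so it has at most \<open>m\<close> edges. One endpoint of each then forms such a
  cover, a contradiction.\<close>

lemma koenig:
  assumes AB: "A \<inter> B = {}" and E: "\<forall>e\<in>E. \<exists>a\<in>A. \<exists>b\<in>B. e = {a, b}" and fin: "finite E"
    and small: "\<And>M. matching E M \<Longrightarrow> card M \<le> m"
  shows "\<exists>C. finite C \<and> card C \<le> m \<and> uncovered E C = {}"
proof (rule ccontr)
  let ?has = "\<lambda>F. \<exists>C. finite C \<and> card C \<le> m \<and> uncovered F C = {}"
  assume no: "\<not> ?has E"
  define Z where "Z = {F. F \<subseteq> E \<and> \<not> ?has F}"
  have "E \<in> Z" using no by (simp only: Z_def mem_Collect_eq) simp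
  moreover have "finite Z" using fin by (simp add: Z_def)
  ultimately obtain F where "F \<in> Z" and min: "\<And>F'. F' \<in> Z \<Longrightarrow> F' \<subseteq> F \<Longrightarrow> F' = F"
    using finite_has_minimal2[of Z E] by metis
  then have F: "F \<subseteq> E" "\<not> ?has F" by (auto simp only: Z_def mem_Collect_eq)
  have "disjoint F"
  proof (rule edge_minimal_matching[OF AB, of F m])
    show "\<forall>e\<in>F. \<exists>a\<in>A. \<exists>b\<in>B. e = {a, b}" using E F(1) by blast
    show "m < card C" if "finite C" "uncovered F C = {}" for C
      using F(2) that by (meson not_le)
    show "?has (F - {e})" if "e \<in> F" for e
    proof (rule ccontr)
      assume "\<not> ?has (F - {e})"
      then have "F - {e} \<in> Z" unfolding Z_def mem_Collect_eq using F(1) by blast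
      then show False using min[of "F - {e}"] that by blast
    qed
  qed
  then have "card F \<le> m" using small F(1) by (auto simp: matching_def)
  moreover have "finite F" using F(1) fin finite_subset by blast
  moreover have "uncovered F ((\<lambda>e. SOME v. v \<in> e) ` F) = {}"
  proof -
    have "(SOME v. v \<in> e) \<in> e" if "e \<in> F" for e
      using E F(1) that by (metis insertI1 someI subsetD)
    then show ?thesis by (auto simp: uncovered_def)
  qed
  ultimately show False
    using F(2) by (meson card_image_le finite_imageI le_trans)
qed

lemma matching_card_le_cover:
  assumes "matching E M" "uncovered E C = {}" "finite C"
  shows "card M \<le> card C"
proof -
  have "\<forall>e\<in>M. \<exists>v. v \<in> e \<inter> C" using assms by (auto simp: matching_def uncovered_def)
  then obtain g where g: "\<forall>e\<in>M. g e \<in> e \<inter> C" by metis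
  have "inj_on g M"
  proof (rule inj_onI)
    fix e f assume ef: "e \<in> M" "f \<in> M" "g e = g f"
    then have "g e \<in> e \<inter> f" using g by (metis IntD1 IntI)
    then show "e = f" using ef assms(1) unfolding matching_def disjoint_def by blast
  qed
  moreover have "g ` M \<subseteq> C" using g by auto
  ultimately show ?thesis using assms(3) card_inj_on_le by blast
qed

lemma max_matching_weight_unit:
  assumes "finite E" "\<forall>e\<in>E. w e = 1"
  shows "max_matching_weight E w \<le> m \<longleftrightarrow> (\<forall>M. matching E M \<longrightarrow> card M \<le> m)"
proof -
  have sub: "matching E M \<Longrightarrow> M \<subseteq> E" for M by (simp add: matching_def)
  have eq: "(\<Sum>e\<in>M. w e) = card M" if "matching E M" for M
    using sub[OF that] assms(2) by (simp add: subset_iff)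
  have fin: "finite {\<Sum>e\<in>M. w e | M. matching E M}"
  proof (rule finite_subset)
    show "{\<Sum>e\<in>M. w e | M. matching E M} \<subseteq> sum w ` Pow E" using sub by auto
  qed (use assms(1) in simp)
  have "matching E {}" by (simp add: matching_def)
  then have "{\<Sum>e\<in>M. w e | M. matching E M} \<noteq> {}" by blast
  then show ?thesis
    unfolding max_matching_weight_def using eq by (auto simp: Max_le_iff[OF fin])
qed

text \<open>A cover of \<open>edges x - I\<close> misses only edges of \<open>I\<close>. Conversely,
  the missed edges can serve as the deletion set, since \<open>S\<close> covers the rest and so
  bounds its matchings.\<close>

lemma unit_bipartite_mmei_yes_iff:
  assumes "x \<in> unit_bipartite_mmei"
  shows "mmei_yes x \<longleftrightarrow>
    (\<exists>S. finite S \<and> card S \<le> bound x \<and> card (uncovered (edges x) S) \<le> budget x)"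
proof -
  obtain A B where AB: "A \<inter> B = {}" and E: "\<forall>e\<in>edges x. \<exists>a\<in>A. \<exists>b\<in>B. e = {a, b}"
    using assms by (auto simp: unit_bipartite_mmei_def bipartite_def)
  have unit: "\<forall>e\<in>edges x. weight x e = 1 \<and> cost x e = 1"
    using assms by (auto simp: unit_bipartite_mmei_def)
  have "edges x \<subseteq> Pow (verts x)" "finite (verts x)"
    using assms by (auto simp: unit_bipartite_mmei_def mmei_instance_def simple_graph_def)
  then have fin: "finite (edges x)" by (meson finite_Pow_iff finite_subset)
  have c: "(\<Sum>e\<in>I. cost x e) = card I" if "I \<subseteq> edges x" for I
    using unit that by (simp add: subset_iff)
  have w: "max_matching_weight (edges x - I) (weight x) \<le> bound x \<longleftrightarrow>
      (\<forall>M. matching (edges x - I) M \<longrightarrow> card M \<le> bound x)" for I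
    by (rule max_matching_weight_unit) (use fin unit in auto)
  show ?thesis
  proof
    assume "mmei_yes x"
    then obtain I where I: "I \<subseteq> edges x" "card I \<le> budget x"
        "\<forall>M. matching (edges x - I) M \<longrightarrow> card M \<le> bound x"
      unfolding mmei_yes_def using c w by auto
    obtain S where S: "finite S" "card S \<le> bound x" "uncovered (edges x - I) S = {}"
      using koenig[OF AB, of "edges x - I" "bound x"] E I fin by auto
    have "uncovered (edges x) S \<subseteq> I" using S(3) by (auto simp: uncovered_def)
    then have "card (uncovered (edges x) S) \<le> budget x"
      using I fin by (meson card_mono finite_subset le_trans)
    then show "\<exists>S. finite S \<and> card S \<le> bound x \<and> card (uncovered (edges x) S) \<le> budget x"
      using S by blast
  next
    assume "\<exists>S. finite S \<and> card S \<le> bound x \<and> card (uncovered (edges x) S) \<le> budget x"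
    then obtain S where S: "finite S" "card S \<le> bound x"
      "card (uncovered (edges x) S) \<le> budget x" by blast
    let ?I = "uncovered (edges x) S"
    have "uncovered (edges x - ?I) S = {}" by (auto simp: uncovered_def)
    then have "\<forall>M. matching (edges x - ?I) M \<longrightarrow> card M \<le> bound x"
      using matching_card_le_cover S by (meson le_trans)
    moreover have "?I \<subseteq> edges x" by (auto simp: uncovered_def)
    ultimately show "mmei_yes x"
      unfolding mmei_yes_def using S c w by metis
  qed
qed

section \<open>Branching on the undecided vertex of largest residual degree\<close>

definition residual_degree :: "'a set set \<Rightarrow> 'a set \<Rightarrow> 'a \<Rightarrow> nat" where
  "residual_degree E T v = card {e \<in> uncovered E T. v \<in> e}"

lemma card_uncovered_insert:
  assumes "finite E"
  shows "card (uncovered E (insert v T)) = card (uncovered E T) - residual_degree E T v"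
proof -
  have "uncovered E (insert v T) = uncovered E T - {e \<in> uncovered E T. v \<in> e}"
    by (auto simp: uncovered_def)
  then show ?thesis unfolding residual_degree_def using assms by (simp add: card_Diff_subset)
qed

text \<open>Union bound; edges with both ends in \<open>S\<close> are counted twice. It limits the
  gain of a solution of unknown structure.\<close>

lemma card_uncovered_le_sum:
  assumes "finite E" "finite S"
  shows "card (uncovered E T) \<le> card (uncovered E (T \<union> S)) + (\<Sum>v\<in>S. residual_degree E T v)"
proof -
  have "uncovered E T \<subseteq> uncovered E (T \<union> S) \<union> (\<Union>v\<in>S. {e \<in> uncovered E T. v \<in> e})"
    by (auto simp: uncovered_def)
  then have "card (uncovered E T) \<le>
      card (uncovered E (T \<union> S) \<union> (\<Union>v\<in>S. {e \<in> uncovered E T. v \<in> e}))"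
    by (rule card_mono[rotated]) (use assms in auto)
  also have "\<dots> \<le> card (uncovered E (T \<union> S)) + card (\<Union>v\<in>S. {e \<in> uncovered E T. v \<in> e})"
    by (rule card_Un_le)
  also have "card (\<Union>v\<in>S. {e \<in> uncovered E T. v \<in> e}) \<le> (\<Sum>v\<in>S. residual_degree E T v)"
    unfolding residual_degree_def by (rule card_UN_le[OF assms(2)])
  finally show ?thesis by simp
qed

text \<open>Independence makes the union bound exact: no edge meets \<open>I\<close> twice.\<close>

lemma card_uncovered_independent:
  assumes "finite E" "finite I" and ind: "\<And>e v w. e \<in> E \<Longrightarrow> v \<in> I \<inter> e \<Longrightarrow> w \<in> I \<inter> e \<Longrightarrow> v = w"
  shows "card (uncovered E (T \<union> I)) + (\<Sum>v\<in>I. residual_degree E T v) = card (uncovered E T)"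
proof -
  have eq: "uncovered E T = uncovered E (T \<union> I) \<union> (\<Union>v\<in>I. {e \<in> uncovered E T. v \<in> e})"
    by (auto simp: uncovered_def)
  have "card (\<Union>v\<in>I. {e \<in> uncovered E T. v \<in> e}) = (\<Sum>v\<in>I. residual_degree E T v)"
    unfolding residual_degree_def
    by (rule card_UN_disjoint) (use assms in \<open>auto simp: uncovered_def\<close>)
  moreover have "card (uncovered E (T \<union> I) \<union> (\<Union>v\<in>I. {e \<in> uncovered E T. v \<in> e})) =
      card (uncovered E (T \<union> I)) + card (\<Union>v\<in>I. {e \<in> uncovered E T. v \<in> e})"
    by (rule card_Un_disjoint) (use assms in \<open>auto simp: uncovered_def\<close>)
  ultimately show ?thesis using eq by simp
qed

text \<open>\<open>None\<close> counts as degree 0, so the strict comparison in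
  \<open>improve\<close> never picks a vertex of degree 0. The program starts its scan with the same
  value.\<close>

definition pick_value :: "('a \<Rightarrow> nat) \<Rightarrow> 'a option \<Rightarrow> nat" where
  "pick_value \<delta> p = (case p of None \<Rightarrow> 0 | Some v \<Rightarrow> \<delta> v)"

definition improve :: "('a \<Rightarrow> nat) \<Rightarrow> 'a set \<Rightarrow> 'a option \<Rightarrow> 'a \<Rightarrow> 'a option" where
  "improve \<delta> X p u = (if u \<notin> X \<and> pick_value \<delta> p < \<delta> u then Some u else p)"

text \<open>A left fold, so that each iteration of the program's scan is one \<open>improve\<close>,
  with the same tie-breaking.\<close>

definition pick :: "'a list \<Rightarrow> ('a \<Rightarrow> nat) \<Rightarrow> 'a set \<Rightarrow> 'a option" where
  "pick vs \<delta> X = foldl (improve \<delta> X) None vs"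

lemma pick_spec:
  "(\<forall>u \<in> set vs - X. \<delta> u \<le> pick_value \<delta> (pick vs \<delta> X)) \<and>
   (\<forall>v. pick vs \<delta> X = Some v \<longrightarrow> v \<in> set vs - X \<and> \<delta> v > 0)"
proof (induction vs rule: rev_induct)
  case Nil
  then show ?case by (simp add: pick_def)
next
  case (snoc a vs)
  have "pick (vs @ [a]) \<delta> X = improve \<delta> X (pick vs \<delta> X) a" by (simp add: pick_def)
  then show ?case
    using snoc
    by (auto simp: improve_def pick_value_def split: option.splits if_splits)
      (meson DiffI le_trans less_imp_le)
qed

lemma pick_SomeD:
  assumes "pick vs \<delta> X = Some v"
  shows "v \<in> set vs" "v \<notin> X" "\<And>u. u \<in> set vs \<Longrightarrow> u \<notin> X \<Longrightarrow> \<delta> u \<le> \<delta> v" "\<delta> v > 0"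
  using pick_spec[of vs X \<delta>] assms by (auto simp: pick_value_def)

lemma pick_NoneD:
  assumes "pick vs \<delta> X = None" "u \<in> set vs" "u \<notin> X"
  shows "\<delta> u = 0"
  using pick_spec[of vs X \<delta>] assms by (auto simp: pick_value_def)

type_synonym 'a search_state = "'a set \<times> 'a set \<times> nat"

text \<open>A state \<open>(T, X, k)\<close> consists of the vertices taken into the cover, the vertices decided
  (taken or rejected), and the number of vertices that may still be taken. Rejections are never
  revoked.\<close>

definition branch :: "'a list \<Rightarrow> 'a set set \<Rightarrow> bool \<Rightarrow> 'a search_state \<Rightarrow> 'a search_state" where
  "branch vs E c = (\<lambda>(T, X, k).
     case pick vs (residual_degree E T) X of
       None \<Rightarrow> (T, X, k)
     | Some v \<Rightarrow> if c \<and> k \<noteq> 0 then (insert v T, insert v X, k - 1) else (T, insert v X, k))"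

text \<open>Every take spends one unit of \<open>k\<close>, so any bit list whatever leads to an
  admissible set.\<close>

lemma branch_sound:
  "case fold (branch vs E) bs (T, X, k) of (T', _, k') \<Rightarrow>
     \<exists>S. finite S \<and> T' = T \<union> S \<and> card S + k' \<le> k"
proof (induction bs arbitrary: T X k)
  case Nil
  show ?case by (auto intro!: exI[of _ "{}"])
next
  case (Cons b bs)
  show ?case
  proof (cases "\<exists>v. pick vs (residual_degree E T) X = Some v \<and> b \<and> k \<noteq> 0")
    case True
    then obtain v where v: "pick vs (residual_degree E T) X = Some v" "b" "k \<noteq> 0" by blast
    then have eq: "fold (branch vs E) (b # bs) (T, X, k) =
        fold (branch vs E) bs (insert v T, insert v X, k - 1)" by (simp add: branch_def)
    obtain T' X' k' where r: "fold (branch vs E) bs (insert v T, insert v X, k - 1) = (T', X', k')"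
      using prod_cases3 by blast
    obtain S where S: "finite S" "T' = insert v T \<union> S" "card S + k' \<le> k - 1"
      using Cons.IH[where T = "insert v T" and X = "insert v X" and k = "k - 1"] r by auto
    have "card (insert v S) \<le> Suc (card S)" using S(1) by (simp add: card_insert_if)
    then have "finite (insert v S) \<and> T' = T \<union> insert v S \<and> card (insert v S) + k' \<le> k"
      using S v(3) by auto
    then show ?thesis using eq r by (simp del: fold_simps) blast
  next
    case False
    then obtain X' where "branch vs E b (T, X, k) = (T, X', k)"
      by (cases "pick vs (residual_degree E T) X") (auto simp: branch_def)
    then show ?thesis using Cons.IH[where T = T and X = X' and k = k] by simp
  qed
qed

text \<open>The picks made while all of them are rejected. Rejection leaves \<open>T\<close> alone,
  so \<open>\<delta>\<close> is fixed and only \<open>X\<close> grows.\<close>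

fun upcoming :: "'a list \<Rightarrow> ('a \<Rightarrow> nat) \<Rightarrow> nat \<Rightarrow> 'a set \<Rightarrow> 'a set" where
  "upcoming vs \<delta> 0 X = {}"
| "upcoming vs \<delta> (Suc p) X =
     (case pick vs \<delta> X of None \<Rightarrow> {} | Some v \<Rightarrow> insert v (upcoming vs \<delta> p (insert v X)))"

text \<open>The greedy order makes each member dominate every undecided vertex left out. There are
  fewer than \<open>p\<close> members only if nothing of positive degree remains.\<close>

lemma upcoming_spec:
  "finite (upcoming vs \<delta> p X) \<and> upcoming vs \<delta> p X \<inter> X = {} \<and> upcoming vs \<delta> p X \<subseteq> set vs \<and>
   (\<forall>u \<in> upcoming vs \<delta> p X. \<forall>w \<in> set vs - X - upcoming vs \<delta> p X. \<delta> w \<le> \<delta> u) \<and>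
   (card (upcoming vs \<delta> p X) = p \<or> (\<forall>w \<in> set vs - X - upcoming vs \<delta> p X. \<delta> w = 0))"
proof (induction p arbitrary: X)
  case 0
  then show ?case by simp
next
  case (Suc p)
  show ?case
  proof (cases "pick vs \<delta> X")
    case None
    then show ?thesis using pick_NoneD[OF None] by auto
  next
    case (Some v)
    note v = pick_SomeD[OF Some]
    let ?U = "upcoming vs \<delta> p (insert v X)"
    have U: "upcoming vs \<delta> (Suc p) X = insert v ?U" using Some by simp
    have IH: "finite ?U" "?U \<inter> insert v X = {}" "?U \<subseteq> set vs"
      "\<forall>u \<in> ?U. \<forall>w \<in> set vs - insert v X - ?U. \<delta> w \<le> \<delta> u"
      "card ?U = p \<or> (\<forall>w \<in> set vs - insert v X - ?U. \<delta> w = 0)"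
      using Suc[of "insert v X"] by blast+
    have "card (insert v ?U) = Suc (card ?U)" using IH by simp
    then show ?thesis unfolding U using IH v by auto
  qed
qed

definition solves :: "'a set set \<Rightarrow> nat \<Rightarrow> 'a search_state \<Rightarrow> 'a set \<Rightarrow> bool" where
  "solves E b = (\<lambda>(T, X, k) S.
     finite S \<and> card S \<le> k \<and> S \<inter> X = {} \<and> card (uncovered E (T \<union> S)) \<le> b)"

text \<open>Among the next \<open>2 k\<close> picks, \<open>k\<close> lie in one part of the graph, hence are independent. They cover
  at least as many edges as any \<open>k\<close> undecided vertices that avoid all these picks.\<close>

lemma exists_solution_hitting_upcoming:
  assumes AB: "A \<inter> B = {}" and E: "\<forall>e\<in>E. \<exists>a\<in>A. \<exists>b\<in>B. e = {a, b}"
    and V: "set vs \<subseteq> A \<union> B" "\<forall>e\<in>E. e \<subseteq> set vs" and fin: "finite E"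
    and S: "solves E b (T, X, k) S" and k: "k > 0"
  shows "card (uncovered E T) \<le> b \<or>
    (\<exists>S. solves E b (T, X, k) S \<and> S \<inter> upcoming vs (residual_degree E T) (2 * k) X \<noteq> {})"
proof (cases "S \<inter> upcoming vs (residual_degree E T) (2 * k) X = {}")
  case False
  then show ?thesis using S by blast
next
  case True
  let ?d = "residual_degree E T"
  let ?U = "upcoming vs ?d (2 * k) X"
  have U: "finite ?U" "?U \<inter> X = {}" "?U \<subseteq> set vs"
     "\<forall>u \<in> ?U. \<forall>w \<in> set vs - X - ?U. ?d w \<le> ?d u"
     "card ?U = 2 * k \<or> (\<forall>w \<in> set vs - X - ?U. ?d w = 0)"
    using upcoming_spec[of vs ?d "2 * k" X] by blast+
  have S': "finite S" "card S \<le> k" "S \<inter> X = {}" "card (uncovered E (T \<union> S)) \<le> b"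
    using S by (auto simp: solves_def)
  \<comment> \<open>\<open>S\<close> may contain elements outside the graph; they cover
    nothing.\<close>
  have out: "?d w = 0" if "w \<notin> set vs" for w
  proof -
    have "{e \<in> uncovered E T. w \<in> e} = {}" using V(2) that by (auto simp: uncovered_def)
    then show ?thesis unfolding residual_degree_def by (metis card.empty)
  qed
  have le: "card (uncovered E T) \<le> b + (\<Sum>v\<in>S. ?d v)"
    using card_uncovered_le_sum[OF fin S'(1), of T] S'(4) by linarith
  from U(5) show ?thesis
  proof
    \<comment> \<open>The picks ran dry: all of \<open>S\<close> has degree 0, so \<open>T\<close>
      alone already leaves at most \<open>b\<close> edges.\<close>
    assume z: "\<forall>w \<in> set vs - X - ?U. ?d w = 0"
    have "?d w = 0" if "w \<in> S" for w
      using that z out S'(3) True by blast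
    then show ?thesis using le by simp
  next
    assume c: "card ?U = 2 * k"
    have "?U = (?U \<inter> A) \<union> (?U \<inter> B)" using U(3) V(1) by auto
    then have "card ?U \<le> card (?U \<inter> A) + card (?U \<inter> B)" by (metis card_Un_le)
    then have "k \<le> card (?U \<inter> A) \<or> k \<le> card (?U \<inter> B)" using c by linarith
    then obtain D where D: "k \<le> card (?U \<inter> D)" "D = A \<or> D = B" by blast
    obtain I where I: "I \<subseteq> ?U \<inter> D" "card I = k" "finite I"
      using obtain_subset_with_card_n[OF D(1)] by blast
    have ind: "v = w" if "e \<in> E" "v \<in> I \<inter> e" "w \<in> I \<inter> e" for e v w
    proof -
      obtain p q where "p \<in> A" "q \<in> B" "e = {p, q}" using E \<open>e \<in> E\<close> by auto
      then show ?thesis using that I(1) D(2) AB by auto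
    qed
    have "(\<Sum>v\<in>S. ?d v) \<le> (\<Sum>v\<in>I. ?d v)"
    proof -
      \<comment> \<open>Any injection serves: a vertex of \<open>S\<close> avoids \<open>X\<close>
        and the picks, hence is dominated by every pick.\<close>
      obtain g where g: "inj_on g S" "g ` S \<subseteq> I"
        using card_le_inj[OF S'(1) I(3)] S'(2) I(2) by auto
      have "(\<Sum>v\<in>S. ?d v) \<le> (\<Sum>v\<in>S. ?d (g v))"
      proof (rule sum_mono)
        fix v assume v: "v \<in> S"
        have "g v \<in> ?U" using g(2) I(1) v by auto
        then show "?d v \<le> ?d (g v)"
          using U(4) out[of v] S'(3) True v by (cases "v \<in> set vs") auto
      qed
      also have "\<dots> = (\<Sum>v\<in>g ` S. ?d v)" using g(1) by (simp add: sum.reindex)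
      also have "\<dots> \<le> (\<Sum>v\<in>I. ?d v)" by (rule sum_mono2) (use g I in auto)
      finally show ?thesis .
    qed
    then have "card (uncovered E (T \<union> I)) \<le> b"
      using card_uncovered_independent[OF fin I(3), of T] ind le by fastforce
    \<comment> \<open>The exchange brings in undecided vertices only and so respects all earlier
      rejections.\<close>
    moreover have "I \<inter> X = {}" using I(1) U(2) by auto
    moreover have "I \<inter> ?U \<noteq> {}" using I k by (metis card.empty inf.absorb1 le_inf_iff less_numeral_extra(3))
    ultimately show ?thesis using I by (auto simp: solves_def)
  qed
qed

text \<open>Reject picks up to the first that lies in \<open>S\<close>, then take that one. The
  rejected picks are outside \<open>S\<close>, so \<open>S\<close> stays compatible with
  them.\<close>

lemma take_upcoming:
  assumes "solves E b (T, X, k) S" "S \<inter> upcoming vs (residual_degree E T) p X \<noteq> {}"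
  shows "\<exists>q T' X' S'. q < p \<and> k > 0 \<and> solves E b (T', X', k - 1) S' \<and>
    fold (branch vs E) (replicate q False @ [True]) (T, X, k) = (T', X', k - 1)"
  using assms
proof (induction p arbitrary: X)
  case 0
  then show ?case by simp
next
  case (Suc p)
  obtain v where v: "pick vs (residual_degree E T) X = Some v"
    using Suc.prems(2) by (cases "pick vs (residual_degree E T) X") auto
  show ?case
  proof (cases "v \<in> S")
    case True
    have fS: "finite S" using Suc.prems(1) by (simp add: solves_def)
    then have kpos: "k > 0" using Suc.prems(1) True card_gt_0_iff[of S] by (auto simp: solves_def)
    have "insert v T \<union> (S - {v}) = T \<union> S" using True by auto
    then have "solves E b (insert v T, insert v X, k - 1) (S - {v})"
      using Suc.prems(1) True by (auto simp: solves_def)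
    moreover have "fold (branch vs E) (replicate 0 False @ [True]) (T, X, k) =
        (insert v T, insert v X, k - 1)"
      using v kpos by (simp add: branch_def)
    ultimately show ?thesis using kpos by blast
  next
    case False
    then have "solves E b (T, insert v X, k) S" using Suc.prems(1) by (auto simp: solves_def)
    moreover have "S \<inter> upcoming vs (residual_degree E T) p (insert v X) \<noteq> {}"
      using Suc.prems(2) v False by auto
    ultimately obtain q T' X' S' where q: "q < p" "k > 0" "solves E b (T', X', k - 1) S'"
      "fold (branch vs E) (replicate q False @ [True]) (T, insert v X, k) = (T', X', k - 1)"
      using Suc.IH by blast
    have "branch vs E False (T, X, k) = (T, insert v X, k)" using v by (simp add: branch_def)
    then have "fold (branch vs E) (replicate (Suc q) False @ [True]) (T, X, k) = (T', X', k - 1)"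
      using q(4) by simp
    then show ?thesis using q by (metis Suc_less_eq)
  qed
qed

text \<open>Padding: once \<open>T\<close> suffices, the remaining decisions are filled with
  rejections.\<close>

lemma fold_branch_False: "fst (fold (branch vs E) (replicate n False) (T, X, k)) = T"
proof (induction n arbitrary: X)
  case (Suc n)
  have "\<exists>X'. branch vs E False (T, X, k) = (T, X', k)"
    by (auto simp: branch_def split: option.split)
  then show ?case using Suc by auto
qed simp

text \<open>Induction on \<open>k\<close>: one round rejects fewer than \<open>2 * k\<close> picks
  and takes the next, so it costs at most \<open>2 * k\<close> decisions; these costs add up to
  \<open>k * (k + 1)\<close>. Each round may follow a different solution.\<close>

lemma branch_complete:
  assumes AB: "A \<inter> B = {}" and E: "\<forall>e\<in>E. \<exists>a\<in>A. \<exists>b\<in>B. e = {a, b}"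
    and V: "set vs \<subseteq> A \<union> B" "\<forall>e\<in>E. e \<subseteq> set vs" and fin: "finite E"
    and S: "solves E b (T, X, k) S" and n: "k * (k + 1) \<le> n"
  shows "\<exists>bs. length bs = n \<and> card (uncovered E (fst (fold (branch vs E) bs (T, X, k)))) \<le> b"
  using S n
proof (induction k arbitrary: T X S n)
  case 0
  then have "card (uncovered E T) \<le> b" by (auto simp: solves_def)
  then show ?case by (metis fold_branch_False length_replicate)
next
  case (Suc k)
  consider "card (uncovered E T) \<le> b" |
    S' where "solves E b (T, X, Suc k) S'"
      "S' \<inter> upcoming vs (residual_degree E T) (2 * Suc k) X \<noteq> {}"
    using exists_solution_hitting_upcoming[OF AB E V fin Suc.prems(1)] by blast
  then show ?case
  proof cases
    case 1
    then show ?thesis by (metis fold_branch_False length_replicate)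
  next
    case 2
    obtain q T' X' S'' where q: "q < 2 * Suc k" "solves E b (T', X', k) S''"
      "fold (branch vs E) (replicate q False @ [True]) (T, X, Suc k) = (T', X', k)"
      using take_upcoming[OF 2] by auto
    have "k * (k + 1) + Suc q \<le> n"
    proof -
      have "Suc k * (Suc k + 1) = k * (k + 1) + 2 * Suc k" by (simp add: algebra_simps)
      then show ?thesis using q(1) Suc.prems(2) by linarith
    qed
    then obtain bs where bs: "length bs = n - Suc q"
      "card (uncovered E (fst (fold (branch vs E) bs (T', X', k)))) \<le> b"
      using Suc.IH[OF q(2), of "n - Suc q"] by (meson add_le_imp_le_diff)
    have "length ((replicate q False @ [True]) @ bs) = n"
      using bs(1) \<open>k * (k + 1) + Suc q \<le> n\<close> by simp
    moreover have "card (uncovered E (fst (fold (branch vs E)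
        ((replicate q False @ [True]) @ bs) (T, X, Suc k)))) \<le> b"
      using bs(2) by (metis comp_apply fold_append q(3))
    ultimately show ?thesis by blast
  qed
qed

section \<open>Decision sequences as binary digits of a counter\<close>

text \<open>The machine cannot divide. Doubling modulo \<open>P = 2 ^ n\<close> yields the binary digits of a number
  below \<open>P\<close>, the most significant one first.\<close>

definition shift :: "nat \<Rightarrow> nat \<Rightarrow> nat" where
  "shift P y = (if P \<le> y + y then y + y - P else y + y)"

definition digits :: "nat \<Rightarrow> nat \<Rightarrow> nat \<Rightarrow> bool list" where
  "digits P n x = map (\<lambda>i. P \<le> (shift P ^^ i) x + (shift P ^^ i) x) [0..<n]"

fun msb_value :: "bool list \<Rightarrow> nat" where
  "msb_value [] = 0"
| "msb_value (b # bs) = (if b then 2 ^ length bs else 0) + msb_value bs"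

lemma msb_value_less: "msb_value bs < 2 ^ length bs"
  by (induction bs) auto

text \<open>After \<open>i\<close> doublings modulo \<open>P\<close> the first \<open>i\<close>
  digits are gone and the value of the others is scaled by \<open>2 ^ i\<close>. Whether the next
  doubling reaches \<open>P\<close> reveals the next digit.\<close>

lemma digits_surj: "\<exists>x < 2 ^ length bs. digits (2 ^ length bs) (length bs) x = bs"
proof (intro exI conjI)
  let ?P = "2 ^ length bs :: nat"
  let ?x = "msb_value bs"
  show "?x < ?P" by (rule msb_value_less)
  have dec: "msb_value (drop i bs) * 2 ^ i + msb_value (drop i bs) * 2 ^ i =
      (if bs ! i then ?P else 0) + msb_value (drop (Suc i) bs) * 2 ^ Suc i"
    and lt: "msb_value (drop (Suc i) bs) * 2 ^ Suc i < ?P"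
    if i: "i < length bs" for i
  proof -
    have pw: "?P = 2 ^ (length bs - Suc i) * 2 ^ Suc i"
      using i by (metis Suc_leI le_add_diff_inverse2 power_add)
    have "msb_value (drop i bs) =
        (if bs ! i then 2 ^ (length bs - Suc i) else 0) + msb_value (drop (Suc i) bs)"
      using i by (simp add: Cons_nth_drop_Suc[symmetric])
    then show "msb_value (drop i bs) * 2 ^ i + msb_value (drop i bs) * 2 ^ i =
        (if bs ! i then ?P else 0) + msb_value (drop (Suc i) bs) * 2 ^ Suc i"
      unfolding pw by (simp add: algebra_simps)
    show "msb_value (drop (Suc i) bs) * 2 ^ Suc i < ?P"
      unfolding pw using msb_value_less[of "drop (Suc i) bs"] by simp
  qed
  have y: "(shift ?P ^^ i) ?x = msb_value (drop i bs) * 2 ^ i" if "i \<le> length bs" for i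
    using that
  proof (induction i)
    case (Suc i)
    then show ?case using dec[of i] lt[of i] by (auto simp: shift_def)
  qed simp
  show "digits ?P (length bs) ?x = bs"
  proof (rule nth_equalityI)
    fix i assume "i < length (digits ?P (length bs) ?x)"
    then have i: "i < length bs" by (simp add: digits_def)
    show "digits ?P (length bs) ?x ! i = bs ! i"
      using i y[of i] dec[OF i] lt[OF i] by (auto simp: digits_def)
  qed (simp add: digits_def)
qed

lemma search_correct:
  fixes m :: nat
  assumes AB: "A \<inter> B = {}" and E: "\<forall>e\<in>E. \<exists>a\<in>A. \<exists>b\<in>B. e = {a, b}"
    and V: "set vs \<subseteq> A \<union> B" "\<forall>e\<in>E. e \<subseteq> set vs" and fin: "finite E"
  defines "n \<equiv> m * (m + 1)"
  shows "(\<exists>x < 2 ^ n. card (uncovered E (fst (fold (branch vs E) (digits (2 ^ n) n x) ({}, {}, m)))) \<le> b)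
    \<longleftrightarrow> (\<exists>S. finite S \<and> card S \<le> m \<and> card (uncovered E S) \<le> b)"
proof
  assume "\<exists>x < 2 ^ n. card (uncovered E (fst (fold (branch vs E) (digits (2 ^ n) n x) ({}, {}, m)))) \<le> b"
  then obtain x where
    x: "card (uncovered E (fst (fold (branch vs E) (digits (2 ^ n) n x) ({}, {}, m)))) \<le> b"
    by blast
  then show "\<exists>S. finite S \<and> card S \<le> m \<and> card (uncovered E S) \<le> b"
    using branch_sound[where T = "{}" and X = "{}" and k = m and bs = "digits (2 ^ n) n x" and vs = vs and E = E] by (auto split: prod.splits)
next
  assume "\<exists>S. finite S \<and> card S \<le> m \<and> card (uncovered E S) \<le> b"
  then obtain S where S: "solves E b ({}, {}, m) S" by (auto simp: solves_def)
  then obtain bs where bs: "length bs = n"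
    "card (uncovered E (fst (fold (branch vs E) bs ({}, {}, m)))) \<le> b"
    using branch_complete[OF AB E V fin S, of n] n_def by auto
  then show "\<exists>x < 2 ^ n. card (uncovered E (fst (fold (branch vs E) (digits (2 ^ n) n x) ({}, {}, m)))) \<le> b"
    using digits_surj[of bs] by auto
qed

section \<open>Weakest preconditions with running time\<close>

text \<open>Total correctness, with the step count as an argument of the postcondition, so that
  results and time bounds are proved together.\<close>

definition wp :: "prog \<Rightarrow> config \<Rightarrow> (nat \<Rightarrow> config \<Rightarrow> bool) \<Rightarrow> bool" where
  "wp p s Q \<longleftrightarrow> (\<exists>t s'. exec p s t s' \<and> Q t s')"

inductive_cases exec_elims:
  "exec Skip s t s'"
  "exec (Const i n) s t s'"
  "exec (Add i j k) s t s'"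
  "exec (Sub i j k) s t s'"
  "exec (Load i j) s t s'"
  "exec (Store i j) s t s'"
  "exec (Seq p q) s t s'"
  "exec (IfNZ i p q) s t s'"

text \<open>Equivalences, so that the simplifier executes straight-line code symbolically.\<close>

lemma wp_atomic [simp]:
  "wp Skip s Q \<longleftrightarrow> Q 1 s"
  "wp (Const i n) (r, h) Q \<longleftrightarrow> Q 1 (r(i := n), h)"
  "wp (Add i j k) (r, h) Q \<longleftrightarrow> Q 1 (r(i := r j + r k), h)"
  "wp (Sub i j k) (r, h) Q \<longleftrightarrow> Q 1 (r(i := r j - r k), h)"
  "wp (Load i j) (r, h) Q \<longleftrightarrow> Q 1 (r(i := h (r j)), h)"
  "wp (Store i j) (r, h) Q \<longleftrightarrow> Q 1 (r, h(r i := r j))"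
  unfolding wp_def
  by (auto elim!: exec_elims)
    (metis One_nat_def exec.Skip exec.Const exec.Add exec.Sub exec.Load exec.Store surj_pair)+

lemma wp_Seq [simp]: "wp (Seq p q) s Q \<longleftrightarrow> wp p s (\<lambda>t s'. wp q s' (\<lambda>u. Q (t + u)))"
  unfolding wp_def by (blast intro: exec.Seq elim: exec_elims)

lemma wp_IfNZ [simp]:
  "wp (IfNZ i p q) s Q \<longleftrightarrow>
     (if fst s i \<noteq> 0 then wp p s (\<lambda>t. Q (1 + t)) else wp q s (\<lambda>t. Q (1 + t)))"
  unfolding wp_def
  by (auto elim!: exec_elims) (metis exec.IfTrue exec.IfFalse plus_1_eq_Suc neq0_conv)+

lemma wp_mono: "wp p s Q \<Longrightarrow> (\<And>t r h. Q t (r, h) \<Longrightarrow> Q' t (r, h)) \<Longrightarrow> wp p s Q'"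
  unfolding wp_def by (metis surj_pair)

text \<open>All loops are counting loops, so the invariant is indexed by the number of finished
  iterations. Each iteration costs its body and a test; the final failing test adds 1.\<close>

lemma wp_WhileNZ:
  assumes init: "I 0 s"
    and step: "\<And>k r h. k < n \<Longrightarrow> I k (r, h) \<Longrightarrow>
      r i \<noteq> 0 \<and> wp p (r, h) (\<lambda>t s. t \<le> K \<and> I (Suc k) s)"
    and exit: "\<And>r h. I n (r, h) \<Longrightarrow> r i = 0"
  shows "wp (WhileNZ i p) s (\<lambda>t s. t \<le> n * (K + 1) + 1 \<and> I n s)"
proof -
  have "wp (WhileNZ i p) s (\<lambda>t s. t \<le> j * (K + 1) + 1 \<and> I n s)"
    if "j \<le> n" "I (n - j) s" for j s
    using that
  proof (induction j arbitrary: s)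
    case 0
    then have "fst s i = 0" using exit[of "fst s" "snd s"] by simp
    then have "exec (WhileNZ i p) s 1 s" by (rule exec.WhileFalse)
    then show ?case using 0 unfolding wp_def by fastforce
  next
    case (Suc j)
    have "n - Suc j < n" "Suc (n - Suc j) = n - j" using Suc.prems(1) by auto
    then have nz: "fst s i \<noteq> 0" and "wp p s (\<lambda>t s. t \<le> K \<and> I (n - j) s)"
      using step[of "n - Suc j" "fst s" "snd s"] Suc.prems(2) by auto
    then obtain t s1 where 1: "exec p s t s1" "t \<le> K" "I (n - j) s1" by (auto simp: wp_def)
    obtain u s2 where 2: "exec (WhileNZ i p) s1 u s2" "u \<le> j * (K + 1) + 1" "I n s2"
      using Suc.IH[of s1] Suc.prems(1) 1(3) by (auto simp: wp_def)
    have "exec (WhileNZ i p) s (1 + t + u) s2" using nz 1(1) 2(1) by (rule exec.WhileTrue)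
    moreover have "1 + t + u \<le> Suc j * (K + 1) + 1" using 1(2) 2(2) by simp
    ultimately show ?case using 2(3) unfolding wp_def by blast
  qed
  from this[of n s] show ?thesis using init by simp
qed

fun seqs :: "prog list \<Rightarrow> prog" where
  "seqs [] = Skip"
| "seqs (p # ps) = Seq p (seqs ps)"

section \<open>The program\<close>

text \<open>Numbered by nesting depth: inside the search, each level overwrites an interval ending
  at 29 (from 23 for degrees, 18 for picks, 13 for decisions, 10 for runs), which keeps frame
  conditions short. \<open>rZero\<close> is never written and turns \<open>Add\<close> into a
  copy.\<close>

abbreviation (input) "rLen \<equiv> 0 :: nat"
abbreviation (input) "rOne \<equiv> 1 :: nat"
abbreviation (input) "rFour \<equiv> 2 :: nat"
abbreviation (input) "rEdge0 \<equiv> 3 :: nat"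
abbreviation (input) "rEdges \<equiv> 4 :: nat"
abbreviation (input) "rBudget \<equiv> 5 :: nat"
abbreviation (input) "rBound \<equiv> 6 :: nat"
abbreviation (input) "rDepth \<equiv> 7 :: nat"
abbreviation (input) "rPow \<equiv> 8 :: nat"
abbreviation (input) "rVerts \<equiv> 9 :: nat"
abbreviation (input) "rRun \<equiv> 10 :: nat"
abbreviation (input) "rClock \<equiv> 11 :: nat"
abbreviation (input) "rFound \<equiv> 12 :: nat"
abbreviation (input) "rStep \<equiv> 13 :: nat"
abbreviation (input) "rRest \<equiv> 14 :: nat"
abbreviation (input) "rK \<equiv> 15 :: nat"
abbreviation (input) "rY \<equiv> 16 :: nat"
abbreviation (input) "rBit \<equiv> 17 :: nat"
abbreviation (input) "rI \<equiv> 18 :: nat"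
abbreviation (input) "rVPos \<equiv> 19 :: nat"
abbreviation (input) "rBestDeg \<equiv> 20 :: nat"
abbreviation (input) "rBest \<equiv> 21 :: nat"
abbreviation (input) "rU \<equiv> 22 :: nat"
abbreviation (input) "rDeg \<equiv> 23 :: nat"
abbreviation (input) "rJ \<equiv> 24 :: nat"
abbreviation (input) "rEPos \<equiv> 25 :: nat"
abbreviation (input) "rA \<equiv> 26 :: nat"
abbreviation (input) "rB \<equiv> 27 :: nat"
abbreviation (input) "rT \<equiv> 28 :: nat"
abbreviation (input) "rT' \<equiv> 29 :: nat"
abbreviation (input) "rZero \<equiv> 30 :: nat"

text \<open>Once neither endpoint is found to be taken, \<open>a = u\<close> is tested as
  \<open>(a - u) + (u - a) = 0\<close> with truncated subtraction. Steps of 4 skip weight and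
  cost.\<close>

definition degree_body :: prog where
  "degree_body = seqs [
     Load rA rEPos, Add rT rEPos rOne, Load rB rT, Add rEPos rEPos rFour, Sub rJ rJ rOne,
     Add rT rLen rA, Load rT rT, Sub rT rT rClock,
     Add rT' rLen rB, Load rT' rT', Sub rT' rT' rClock, Add rT rT rT',
     IfNZ rT Skip (seqs [
       Sub rT rA rU, Sub rT' rU rA, Add rT rT rT',
       Sub rT' rB rU, Sub rA rU rB, Add rT' rT' rA,
       IfNZ rT (IfNZ rT' Skip (Add rDeg rDeg rOne)) (Add rDeg rDeg rOne)])]"

definition degree_prog :: prog where
  "degree_prog = seqs [
     Add rJ rEdges rZero, Add rEPos rEdge0 rZero, Const rDeg 0, WhileNZ rJ degree_body]"

text \<open>A vertex with mark \<open>h\<close> is decided at clock \<open>c\<close> iff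
  \<open>c \<le> h\<close>, that is, iff \<open>h + 1 - c\<close> is nonzero.\<close>

definition pick_body :: prog where
  "pick_body = seqs [
     Load rU rVPos, Add rVPos rVPos rOne, Sub rI rI rOne,
     Add rT rLen rU, Load rT rT, Add rT rT rOne, Sub rT rT rClock,
     IfNZ rT Skip (seqs [
       degree_prog, Sub rT rDeg rBestDeg,
       IfNZ rT (seqs [Add rBestDeg rDeg rZero, Add rBest rU rZero]) Skip])]"

definition pick_prog :: prog where
  "pick_prog = seqs [
     Const rBestDeg 0, Add rI rVerts rZero, Add rVPos rFour rZero, WhileNZ rI pick_body]"

text \<open>\<open>rBit\<close> becomes \<open>2 * y + 1 - P\<close>, nonzero iff
  \<open>P \<le> 2 * y\<close>. \<open>rBestDeg\<close> is 0 exactly when there is no pick. A set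
  bit with \<open>rK = 0\<close> acts as a rejection. \<open>rRest\<close> drops by the degree of a
  taken vertex, so uncovered edges are never recounted.\<close>

definition branch_body :: prog where
  "branch_body = seqs [
     Sub rStep rStep rOne, pick_prog,
     Add rY rY rY, Add rBit rY rOne, Sub rBit rBit rPow, IfNZ rBit (Sub rY rY rPow) Skip,
     IfNZ rBestDeg (seqs [
       Add rT rLen rBest, Add rT' rClock rZero,
       IfNZ rBit (IfNZ rK (seqs [Sub rK rK rOne, Sub rRest rRest rBestDeg, Add rT' rT' rOne]) Skip) Skip,
       Store rT rT']) Skip]"

definition run_body :: prog where
  "run_body = seqs [
     Sub rRun rRun rOne, Add rY rRun rZero, Add rRest rEdges rZero, Add rK rBound rZero,
     Add rStep rDepth rZero, WhileNZ rStep branch_body,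
     Sub rT rRest rBudget, IfNZ rT Skip (Const rFound 1),
     Add rClock rClock rOne, Add rClock rClock rOne]"

text \<open>Adding \<open>2 * k\<close> for \<open>k = m, ..., 1\<close> yields
  \<open>m * (m + 1)\<close> without multiplication.\<close>

definition depth_body :: prog where
  "depth_body = seqs [Add rDepth rDepth rK, Add rDepth rDepth rK, Sub rK rK rOne]"

definition depth_prog :: prog where
  "depth_prog = seqs [Add rK rBound rZero, Const rDepth 0, WhileNZ rK depth_body]"

definition power_body :: prog where
  "power_body = seqs [Add rPow rPow rPow, Sub rStep rStep rOne]"

definition power_prog :: prog where
  "power_prog = seqs [Const rPow 1, WhileNZ rStep power_body]"

text \<open>The clock starts at 1, so that the zero cells behind the input count as
  undecided.\<close>

definition mmei_prog :: prog where
  "mmei_prog = seqs [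
     Const rOne 1, Const rFour 4, Load rVerts rZero, Load rEdges rOne,
     Const rT 2, Load rBudget rT, Const rT 3, Load rBound rT, Add rEdge0 rFour rVerts,
     depth_prog, Add rStep rDepth rZero, power_prog,
     Const rClock 1, Add rRun rPow rZero, WhileNZ rRun run_body,
     Add rLen rFound rZero]"

definition bound_prog :: prog where
  "bound_prog = seqs [
     Const rOne 1, Load rBound rZero, depth_prog, Add rStep rDepth rDepth, power_prog,
     Add rLen rPow rZero]"

section \<open>Correctness and running time of the search loops\<close>

definition alive_at :: "'a set \<Rightarrow> 'a \<Rightarrow> 'a \<times> 'a \<Rightarrow> bool" where
  "alive_at T u = (\<lambda>(a, b). (a = u \<or> b = u) \<and> a \<notin> T \<and> b \<notin> T)"

text \<open>Distinct endpoint sets rule out an edge listed in both orientations, so list entries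
  count edges.\<close>

lemma length_filter_alive:
  assumes "distinct (map (\<lambda>(u, v). {u, v}) es)"
  shows "length (filter (alive_at T u) es) =
    residual_degree (set (map (\<lambda>(u, v). {u, v}) es)) T u"
proof -
  let ?S = "\<lambda>(u, v). {u, v}"
  let ?fs = "filter (alive_at T u) es"
  have "distinct (map ?S ?fs)" using assms by (simp add: distinct_map inj_on_def)
  then have "length ?fs = card (set (map ?S ?fs))" using distinct_card by fastforce
  also have "set (map ?S ?fs) = {e \<in> uncovered (set (map ?S es)) T. u \<in> e}"
    by (force simp: alive_at_def uncovered_def)
  finally show ?thesis by (simp add: residual_degree_def)
qed

lemma wp_degree_body:
  assumes "r rOne = 1" "r rFour = 4"
  shows "wp degree_body (r, h) (\<lambda>t s. t \<le> 24 \<and> snd s = h \<and>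
    fst s rEPos = r rEPos + 4 \<and> fst s rJ = r rJ - 1 \<and>
    fst s rDeg = r rDeg + (if alive_at {v. r rClock < h (r rLen + v)} (r rU)
      (h (r rEPos), h (Suc (r rEPos))) then 1 else 0) \<and>
    (\<forall>i. i \<notin> {23..29} \<longrightarrow> fst s i = r i))"
  using assms by (auto simp: degree_body_def alive_at_def)

definition constants_set :: "nat \<Rightarrow> nat \<Rightarrow> nat \<Rightarrow> (nat \<Rightarrow> nat) \<Rightarrow> bool" where
  "constants_set N n e r \<longleftrightarrow> r rLen = N \<and> r rOne = 1 \<and> r rFour = 4 \<and> r rEdge0 = 4 + n \<and>
     r rEdges = e \<and> r rVerts = n \<and> r rZero = 0"

lemma constants_set_cong:
  assumes "constants_set N n e r" "\<forall>i. i \<notin> {10..29} \<longrightarrow> r' i = r i"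
  shows "constants_set N n e r'"
  using assms by (simp add: constants_set_def)

definition layout :: "nat list \<Rightarrow> (nat \<times> nat) list \<Rightarrow> (nat \<Rightarrow> nat) \<Rightarrow> bool" where
  "layout vs es h \<longleftrightarrow> (\<forall>i < length vs. h (4 + i) = vs ! i) \<and>
     (\<forall>j < length es. h (4 + length vs + 4 * j) = fst (es ! j) \<and>
       h (Suc (4 + length vs + 4 * j)) = snd (es ! j))"

lemma wp_degree_prog:
  assumes C: "constants_set N (length vs) (length es) r" and L: "layout vs es h"
  defines "T \<equiv> {v. r rClock < h (N + v)}"
  shows "wp degree_prog (r, h) (\<lambda>t s. t \<le> 25 * length es + 6 \<and> snd s = h \<and>
    fst s rDeg = length (filter (alive_at T (r rU)) es) \<and>
    (\<forall>i. i \<notin> {23..29} \<longrightarrow> fst s i = r i))"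
proof -
  let ?I = "\<lambda>k s. snd s = h \<and> fst s rJ = length es - k \<and> fst s rEPos = 4 + length vs + 4 * k \<and>
    fst s rDeg = length (filter (alive_at T (r rU)) (take k es)) \<and>
    (\<forall>i. i \<notin> {23..29} \<longrightarrow> fst s i = r i)"
  have step: "r1 rJ \<noteq> 0 \<and> wp degree_body (r1, h1) (\<lambda>t s. t \<le> 24 \<and> ?I (Suc k) s)"
    if k: "k < length es" and I: "?I k (r1, h1)" for k r1 h1
  proof
    show "r1 rJ \<noteq> 0" using k I by simp
    have r1: "r1 rOne = 1" "r1 rFour = 4" "r1 rClock = r rClock" "r1 rLen = N" "r1 rU = r rU"
      using I C by (simp_all add: constants_set_def)
    have e: "(h1 (r1 rEPos), h1 (Suc (r1 rEPos))) = es ! k"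
      using L k I by (simp add: layout_def)
    have T: "{v. r1 rClock < h1 (r1 rLen + v)} = T" using I r1 by (simp add: T_def)
    show "wp degree_body (r1, h1) (\<lambda>t s. t \<le> 24 \<and> ?I (Suc k) s)"
    proof (rule wp_mono[OF wp_degree_body[OF r1(1,2)]], unfold e T, goal_cases)
      case (1 t r2 h2)
      then show ?case using k I r1 by (auto simp: take_Suc_conv_app_nth)
    qed
  qed
  have loop: "wp (WhileNZ rJ degree_body) s (\<lambda>t s. t \<le> length es * (24 + 1) + 1 \<and> ?I (length es) s)"
    if "?I 0 s" for s
    by (rule wp_WhileNZ[where I = ?I]) (use that step in auto)
  show ?thesis
    unfolding degree_prog_def
    apply simp
    apply (rule wp_mono[OF loop])
    using C apply (auto simp: constants_set_def)
    done
qed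

lemma wp_pick_body:
  fixes vs :: "nat list" and es :: "(nat \<times> nat) list"
  assumes C: "constants_set N (length vs) (length es) r" and L: "layout vs es h"
  defines "T \<equiv> {v. r rClock < h (N + v)}" and "X \<equiv> {v. r rClock \<le> h (N + v)}"
  defines "\<delta> \<equiv> \<lambda>u. length (filter (alive_at T u) es)"
  assumes p: "r rBestDeg = pick_value \<delta> p" "\<And>v. p = Some v \<Longrightarrow> r rBest = v"
  shows "wp pick_body (r, h) (\<lambda>t s. t \<le> 25 * length es + 22 \<and> snd s = h \<and>
    fst s rI = r rI - 1 \<and> fst s rVPos = r rVPos + 1 \<and>
    (let p' = improve \<delta> X p (h (r rVPos)) in
      fst s rBestDeg = pick_value \<delta> p' \<and> (\<forall>v. p' = Some v \<longrightarrow> fst s rBest = v)) \<and>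
    (\<forall>i. i \<notin> {18..29} \<longrightarrow> fst s i = r i))"
proof (cases "h (r rVPos) \<in> X")
  case True
  then have "improve \<delta> X p (h (r rVPos)) = p" by (simp add: improve_def)
  moreover have "Suc (h (N + h (r rVPos))) - r rClock \<noteq> 0" using True by (simp add: X_def)
  ultimately show ?thesis
    using p C by (simp add: pick_body_def constants_set_def)
next
  case False
  then have z: "Suc (h (N + h (r rVPos))) - r rClock = 0" by (simp add: X_def)
  let ?r = "r(rU := h (r rVPos), rVPos := Suc (r rVPos), rI := r rI - Suc 0, rT := 0)"
  have "constants_set N (length vs) (length es) ?r"
    using C by (rule constants_set_cong) simp
  note d = wp_degree_prog[OF this L]
  define p' where "p' = improve \<delta> X p (h (r rVPos))"
  have p': "p' = (if pick_value \<delta> p < \<delta> (h (r rVPos)) then Some (h (r rVPos)) else p)"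
    using False by (simp add: improve_def p'_def)
  have deg: "length (filter (alive_at T u) es) = \<delta> u" for u by (simp add: \<delta>_def)
  have val: "pick_value \<delta> (Some u) = \<delta> u" for u by (simp add: pick_value_def)
  show ?thesis
    unfolding pick_body_def p'_def[symmetric]
    using C z
    apply (simp add: constants_set_def)
    apply (rule wp_mono[OF d])
    using p C p' val
    apply (auto simp: constants_set_def T_def[symmetric] deg)
    done
qed

lemma wp_pick_prog:
  assumes C: "constants_set N (length vs) (length es) r" and L: "layout vs es h"
  defines "T \<equiv> {v. r rClock < h (N + v)}" and "X \<equiv> {v. r rClock \<le> h (N + v)}"
  defines "\<delta> \<equiv> \<lambda>u. length (filter (alive_at T u) es)"
  shows "wp pick_prog (r, h) (\<lambda>t s. t \<le> length vs * (25 * length es + 23) + 5 \<and> snd s = h \<and>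
    fst s rBestDeg = pick_value \<delta> (pick vs \<delta> X) \<and>
    (\<forall>v. pick vs \<delta> X = Some v \<longrightarrow> fst s rBest = v) \<and>
    (\<forall>i. i \<notin> {18..29} \<longrightarrow> fst s i = r i))"
proof -
  let ?I = "\<lambda>k s. snd s = h \<and> fst s rI = length vs - k \<and> fst s rVPos = 4 + k \<and>
    fst s rBestDeg = pick_value \<delta> (pick (take k vs) \<delta> X) \<and>
    (\<forall>v. pick (take k vs) \<delta> X = Some v \<longrightarrow> fst s rBest = v) \<and>
    (\<forall>i. i \<notin> {18..29} \<longrightarrow> fst s i = r i)"
  have step: "r1 rI \<noteq> 0 \<and> wp pick_body (r1, h1) (\<lambda>t s. t \<le> 25 * length es + 22 \<and> ?I (Suc k) s)"
    if k: "k < length vs" and I: "?I k (r1, h1)" for k r1 h1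
  proof
    show "r1 rI \<noteq> 0" using k I by simp
    have h1: "h1 = h" "r1 rClock = r rClock" using I by simp_all
    have u: "h (r1 rVPos) = vs ! k" using L k I by (simp add: layout_def)
    have pk: "pick (take (Suc k) vs) \<delta> X = improve \<delta> X (pick (take k vs) \<delta> X) (vs ! k)"
      using k by (simp add: pick_def take_Suc_conv_app_nth)
    have C1: "constants_set N (length vs) (length es) r1"
      using C by (rule constants_set_cong) (use I in simp)
    note body = wp_pick_body[OF C1 L, unfolded h1, folded T_def X_def, folded \<delta>_def,
        of "pick (take k vs) \<delta> X", unfolded u, folded pk]
    show "wp pick_body (r1, h1) (\<lambda>t s. t \<le> 25 * length es + 22 \<and> ?I (Suc k) s)"
      unfolding h1
    proof (rule wp_mono[OF body], goal_cases)
      case (3 t r2 h2)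
      then show ?case using k I by (auto simp: Let_def)
    qed (use I in auto)
  qed
  have loop: "wp (WhileNZ rI pick_body) s
      (\<lambda>t s. t \<le> length vs * (25 * length es + 22 + 1) + 1 \<and> ?I (length vs) s)"
    if "?I 0 s" for s
    by (rule wp_WhileNZ[where I = ?I]) (use that step in auto)
  show ?thesis
    unfolding pick_prog_def
    apply simp
    apply (rule wp_mono[OF loop])
    using C apply (auto simp: constants_set_def pick_def pick_value_def add.commute)
    done
qed

text \<open>A decision on vertex \<open>v\<close> is recorded in cell \<open>N + v\<close>, behind the input: \<open>c\<close> if \<open>v\<close> is rejected
  and \<open>c + 1\<close> if it is taken. The clock \<open>c\<close> advances by \<open>2\<close> from one decision sequence to the next,
  so that older marks count as undecided and the memory need not be cleared.\<close>

definition marks :: "nat \<Rightarrow> nat \<Rightarrow> (nat \<Rightarrow> nat) \<Rightarrow> nat search_state \<Rightarrow> bool" where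
  "marks N c h = (\<lambda>(T, X, k). T = {v. c < h (N + v)} \<and> X = {v. c \<le> h (N + v)} \<and>
     (\<forall>a \<ge> N. h a \<le> c + 1))"

lemma layout_upd:
  assumes "layout vs es h" "4 + length vs + 4 * length es \<le> a"
  shows "layout vs es (h(a := x))"
  using assms by (auto simp: layout_def)

lemma wp_branch_body:
  fixes vs :: "nat list" and es :: "(nat \<times> nat) list"
  defines "E \<equiv> set (map (\<lambda>(u, v). {u, v}) es)"
  assumes dist: "distinct (map (\<lambda>(u, v). {u, v}) es)"
    and C: "constants_set N (length vs) (length es) r" and L: "layout vs es h"
    and N: "4 + length vs + 4 * length es \<le> N"
    and M: "marks N (r rClock) h (T, X, k)"
    and r: "r rK = k" "r rRest = card (uncovered E T)"
  shows "wp branch_body (r, h) (\<lambda>t s. t \<le> length vs * (25 * length es + 23) + 25 \<and>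
    (case branch vs E (r rPow \<le> r rY + r rY) (T, X, k) of (T', X', k') \<Rightarrow>
      marks N (r rClock) (snd s) (T', X', k') \<and> fst s rK = k' \<and>
      fst s rRest = card (uncovered E T')) \<and>
    layout vs es (snd s) \<and> fst s rStep = r rStep - 1 \<and> fst s rY = shift (r rPow) (r rY) \<and>
    (\<forall>i. i \<notin> {13..29} \<longrightarrow> fst s i = r i))"
proof -
  let ?\<delta> = "residual_degree E T"
  have \<delta>: "(\<lambda>u. length (filter (alive_at T u) es)) = ?\<delta>"
    unfolding E_def using length_filter_alive[OF dist] by blast
  have TX: "T = {v. r rClock < h (N + v)}" "X = {v. r rClock \<le> h (N + v)}"
    "\<And>a. N \<le> a \<Longrightarrow> h a \<le> Suc (r rClock)"
    using M by (auto simp: marks_def)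
  let ?r = "r(rStep := r rStep - Suc 0)"
  have C': "constants_set N (length vs) (length es) ?r"
    using C by (rule constants_set_cong) simp
  have "wp pick_prog (?r, h) (\<lambda>t s. t \<le> length vs * (25 * length es + 23) + 5 \<and> snd s = h \<and>
      fst s rBestDeg = pick_value ?\<delta> (pick vs ?\<delta> X) \<and>
      (\<forall>v. pick vs ?\<delta> X = Some v \<longrightarrow> fst s rBest = v) \<and>
      (\<forall>i. i \<notin> {18..29} \<longrightarrow> fst s i = ?r i))"
    using wp_pick_prog[OF C' L] \<delta> TX by simp
  note pick = this
  have finE: "finite E" by (simp add: E_def)
  have bit: "(0 < Suc (y + y) - P) = (P \<le> y + y)" for y P :: nat by auto
  show ?thesis
  proof (cases "pick vs ?\<delta> X")
    case None
    then show ?thesis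
      unfolding branch_body_def
      using C
      apply (simp add: constants_set_def)
      apply (rule wp_mono[OF pick])
      using C M r L
      apply (auto simp: constants_set_def branch_def pick_value_def shift_def bit)
      done
  next
    case (Some v)
    note v = pick_SomeD[OF Some]
    have vN: "4 + length vs + 4 * length es \<le> N + v" using N by simp
    \<comment> \<open>\<open>v\<close> is undecided, so its old mark is below the clock, and writing
      the clock there cannot remove \<open>v\<close> from \<open>T\<close>.\<close>
    have rej: "marks N (r rClock) (h(N + v := r rClock)) (T, insert v X, k)"
      using TX v by (auto simp: marks_def)
    have tak: "marks N (r rClock) (h(N + v := Suc (r rClock))) (insert v T, insert v X, k')" for k'
      using TX v by (auto simp: marks_def)
    show ?thesis
      unfolding branch_body_def
      using C
      apply (simp add: constants_set_def)
      apply (rule wp_mono[OF pick])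
      using C r v Some rej tak layout_upd[OF L vN] card_uncovered_insert[OF finE, of v T]
      apply (auto simp: constants_set_def branch_def pick_value_def shift_def bit)
      done
  qed
qed

lemma wp_run_body:
  fixes vs :: "nat list" and es :: "(nat \<times> nat) list"
  defines "E \<equiv> set (map (\<lambda>(u, v). {u, v}) es)"
  assumes dist: "distinct (map (\<lambda>(u, v). {u, v}) es)"
    and C: "constants_set N (length vs) (length es) r" and L: "layout vs es h"
    and N: "4 + length vs + 4 * length es \<le> N"
    and M: "\<forall>a \<ge> N. h a < r rClock" and card: "length es = card E"
  shows "wp run_body (r, h) (\<lambda>t s.
    t \<le> r rDepth * (length vs * (25 * length es + 23) + 26) + 13 \<and>
    layout vs es (snd s) \<and> (\<forall>a \<ge> N. snd s a < fst s rClock) \<and> fst s rRun = r rRun - 1 \<and>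
    fst s rFound = (if card (uncovered E (fst (fold (branch vs E)
        (digits (r rPow) (r rDepth) (r rRun - 1)) ({}, {}, r rBound)))) \<le> r rBudget
      then 1 else r rFound) \<and>
    (\<forall>i. i \<notin> {10..29} \<longrightarrow> fst s i = r i))"
proof -
  let ?x = "r rRun - 1" and ?P = "r rPow" and ?c = "r rClock"
  let ?r = "r(rRun := ?x)"
  define \<sigma> where "\<sigma> k = fold (branch vs E) (digits ?P k ?x) ({}, {}, r rBound)" for k
  have \<sigma>_Suc: "\<sigma> (Suc k) = branch vs E (?P \<le> (shift ?P ^^ k) ?x + (shift ?P ^^ k) ?x) (\<sigma> k)" for k
    by (simp add: \<sigma>_def digits_def)
  have \<sigma>_0: "\<sigma> 0 = ({}, {}, r rBound)" by (simp add: \<sigma>_def digits_def)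
  let ?A = "length vs * (25 * length es + 23) + 25"
  let ?I = "\<lambda>k s. layout vs es (snd s) \<and> marks N ?c (snd s) (\<sigma> k) \<and>
    fst s rK = snd (snd (\<sigma> k)) \<and> fst s rRest = card (uncovered E (fst (\<sigma> k))) \<and>
    fst s rStep = r rDepth - k \<and> fst s rY = (shift ?P ^^ k) ?x \<and>
    (\<forall>i. i \<notin> {13..29} \<longrightarrow> fst s i = ?r i)"
  have step: "r1 rStep \<noteq> 0 \<and> wp branch_body (r1, h1) (\<lambda>t s. t \<le> ?A \<and> ?I (Suc k) s)"
    if k: "k < r rDepth" and I: "?I k (r1, h1)" for k r1 h1
  proof
    show "r1 rStep \<noteq> 0" using k I by simp
    obtain T X j where s: "\<sigma> k = (T, X, j)" using prod_cases3 by blast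
    obtain T' X' j' where s': "\<sigma> (Suc k) = (T', X', j')" using prod_cases3 by blast
    have C1: "constants_set N (length vs) (length es) r1"
      using C by (rule constants_set_cong) (use I in simp)
    have r1: "r1 rClock = ?c" "r1 rPow = ?P" "r1 rY = (shift ?P ^^ k) ?x" using I by simp_all
    have b: "branch vs E (?P \<le> (shift ?P ^^ k) ?x + (shift ?P ^^ k) ?x) (T, X, j) = (T', X', j')"
      using \<sigma>_Suc[of k] s s' by simp
    have L1: "layout vs es h1" using I by simp
    have M1: "marks N (r1 rClock) h1 (T, X, j)" using I s r1 by simp
    have k1: "r1 rK = j" "r1 rRest = card (uncovered (set (map (\<lambda>(u, v). {u, v}) es)) T)"
      using I s by (simp_all add: E_def)
    note body = wp_branch_body[OF dist C1 L1 N M1 k1, folded E_def, unfolded r1 b]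
    show "wp branch_body (r1, h1) (\<lambda>t s. t \<le> ?A \<and> ?I (Suc k) s)"
      by (rule wp_mono[OF body]) (use I s' in auto)
  qed
  have loop: "wp (WhileNZ rStep branch_body) s (\<lambda>t s. t \<le> r rDepth * (?A + 1) + 1 \<and> ?I (r rDepth) s)"
    if "?I 0 s" for s
    by (rule wp_WhileNZ[where I = ?I]) (use that step in auto)
  have m0: "marks N ?c h ({}, {}, r rBound)"
  proof -
    have "\<not> ?c < h (N + v)" "\<not> ?c \<le> h (N + v)" for v using M by (simp_all add: not_less not_le less_imp_le)
    moreover have "\<forall>a \<ge> N. h a \<le> ?c + 1" using M by (simp add: le_SucI less_imp_le)
    ultimately show ?thesis by (simp add: marks_def)
  qed
  have u0: "card (uncovered E {}) = length es" using card by (simp add: uncovered_def)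
  \<comment> \<open>Marks never exceed \<open>?c + 1\<close>, so advancing the clock by 2 makes all
    of them stale.\<close>
  have M': "h1 a < Suc (Suc ?c)" if "marks N ?c h1 (\<sigma> D)" "N \<le> a" for h1 a D
    using that by (cases "\<sigma> D") (auto simp: marks_def less_Suc_eq_le)
  define q where "q = (if card (uncovered E (fst (\<sigma> (r rDepth)))) \<le> r rBudget then 1 else r rFound)"
  show ?thesis
    unfolding run_body_def \<sigma>_def[symmetric] q_def[symmetric]
    using C
    apply (simp add: constants_set_def)
    apply (rule wp_mono[OF loop])
    using C m0 u0 M' L
    apply (auto simp: constants_set_def \<sigma>_0 q_def algebra_simps)
    done
qed

section \<open>Depth, powers of two, and the whole program\<close>

lemma wp_depth_prog:
  assumes "r rZero = 0" "r rOne = 1"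
  shows "wp depth_prog (r, h) (\<lambda>t s. t \<le> 5 * r rBound + 4 \<and> snd s = h \<and>
    fst s rDepth = r rBound * (r rBound + 1) \<and> (\<forall>i. i \<notin> {rDepth, rK} \<longrightarrow> fst s i = r i))"
proof -
  let ?m = "r rBound"
  \<comment> \<open>The sum so far plus the part still to come is constant.\<close>
  let ?I = "\<lambda>k s. snd s = h \<and> fst s rK = ?m - k \<and>
    fst s rDepth + (?m - k) * (?m - k + 1) = ?m * (?m + 1) \<and>
    (\<forall>i. i \<notin> {rDepth, rK} \<longrightarrow> fst s i = r i)"
  have step: "r1 rK \<noteq> 0 \<and> wp depth_body (r1, h1) (\<lambda>t s. t \<le> 4 \<and> ?I (Suc k) s)"
    if "k < ?m" "?I k (r1, h1)" for k r1 h1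
  proof -
    obtain j where j: "?m = Suc (k + j)" using \<open>k < ?m\<close> less_iff_Suc_add by blast
    then show ?thesis using that assms unfolding depth_body_def j by (auto simp: algebra_simps)
  qed
  have loop: "wp (WhileNZ rK depth_body) s (\<lambda>t s. t \<le> ?m * (4 + 1) + 1 \<and> ?I ?m s)"
    if "?I 0 s" for s
    by (rule wp_WhileNZ[where I = ?I]) (use that step in auto)
  show ?thesis
    unfolding depth_prog_def
    apply simp
    apply (rule wp_mono[OF loop])
    using assms apply auto
    done
qed

lemma wp_power_prog:
  assumes "r rOne = 1"
  shows "wp power_prog (r, h) (\<lambda>t s. t \<le> 4 * r rStep + 3 \<and> snd s = h \<and>
    fst s rPow = 2 ^ r rStep \<and> (\<forall>i. i \<notin> {rPow, rStep} \<longrightarrow> fst s i = r i))"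
proof -
  let ?I = "\<lambda>k s. snd s = h \<and> fst s rStep = r rStep - k \<and> fst s rPow = 2 ^ k \<and>
    (\<forall>i. i \<notin> {rPow, rStep} \<longrightarrow> fst s i = r i)"
  have step: "r1 rStep \<noteq> 0 \<and> wp power_body (r1, h1) (\<lambda>t s. t \<le> 3 \<and> ?I (Suc k) s)"
    if "k < r rStep" "?I k (r1, h1)" for k r1 h1
    using that assms unfolding power_body_def by auto
  have loop: "wp (WhileNZ rStep power_body) s (\<lambda>t s. t \<le> r rStep * (3 + 1) + 1 \<and> ?I (r rStep) s)"
    if "?I 0 s" for s
    by (rule wp_WhileNZ[where I = ?I]) (use that step in auto)
  show ?thesis
    unfolding power_prog_def
    apply simp
    apply (rule wp_mono[OF loop])
    apply auto
    done
qed

lemma computes_withinI: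
  assumes "wp p (initial_config ws) (\<lambda>t s. t \<le> T \<and> fst s 0 = y)"
  shows "computes_within p ws T y"
  using assms by (auto simp: wp_def computes_within_def)

text \<open>The parameter-dependent factor of the running time: the square of the number of decision
  sequences.\<close>

lemma computable_bound: "computable (\<lambda>k. 2 ^ (2 * (k * (k + 1))))"
  unfolding computable_def
proof (intro exI allI)
  fix k :: nat
  let ?T = "5 * k + 8 * (k * (k + 1)) + 20"
  show "computes_within bound_prog [k] ?T (2 ^ (2 * (k * (k + 1))))"
    apply (rule computes_withinI)
    apply (simp add: bound_prog_def initial_config_def)
    apply (rule wp_mono)
     apply (rule wp_depth_prog)
      apply simp
     apply simp
    apply simp
    apply (rule wp_mono)
     apply (rule wp_power_prog)
     apply simp
    apply (auto simp: algebra_simps)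
    done
qed

lemma wp_mmei_prog:
  fixes vs :: "nat list" and es :: "(nat \<times> nat) list"
  defines "E \<equiv> set (map (\<lambda>(u, v). {u, v}) es)"
  assumes dist: "distinct (map (\<lambda>(u, v). {u, v}) es)" and L: "layout vs es h"
    and h: "h 0 = length vs" "h 1 = length es" "h 2 = b" "h 3 = m"
    and N: "4 + length vs + 4 * length es \<le> N" and M: "\<forall>a \<ge> N. h a = 0"
  defines "D \<equiv> m * (m + 1)"
  shows "wp mmei_prog ((\<lambda>_. 0)(0 := N), h) (\<lambda>t s.
    t \<le> 2 ^ D * (D * (length vs * (25 * length es + 23) + 26) + 14) + 9 * D + 30 \<and>
    fst s 0 = (if \<exists>x < 2 ^ D. card (uncovered E (fst (fold (branch vs E)
      (digits (2 ^ D) D x) ({}, {}, m)))) \<le> b then 1 else 0))"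
proof -
  let ?P = "2 ^ D :: nat"
  let ?A = "D * (length vs * (25 * length es + 23) + 26) + 13"
  define acc where "acc x \<longleftrightarrow> card (uncovered E (fst (fold (branch vs E)
      (digits ?P D x) ({}, {}, m)))) \<le> b" for x
  have card: "length es = card E"
    unfolding E_def using distinct_card[OF dist] by simp
  define ok where "ok r \<longleftrightarrow> constants_set N (length vs) (length es) r \<and> r rPow = ?P \<and>
    r rDepth = D \<and> r rBound = m \<and> r rBudget = b" for r
  have ok_cong: "ok r'" if "ok r" "\<forall>i. i \<notin> {10..29} \<longrightarrow> r' i = r i" for r r' :: "nat \<Rightarrow> nat"
    using that constants_set_cong[of N "length vs" "length es" r r'] by (simp add: ok_def)
  \<comment> \<open>The counter runs downward: after \<open>k\<close> runs the values from
    \<open>?P - k\<close> to \<open>?P - 1\<close> have been tried. \<open>rFound\<close> is never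
    reset.\<close>
  let ?I = "\<lambda>k s. layout vs es (snd s) \<and> (\<forall>a \<ge> N. snd s a < fst s rClock) \<and>
    fst s rRun = ?P - k \<and> ok (fst s) \<and>
    fst s rFound = (if \<exists>x. ?P - k \<le> x \<and> x < ?P \<and> acc x then 1 else 0)"
  have step: "r1 rRun \<noteq> 0 \<and> wp run_body (r1, h1) (\<lambda>t s. t \<le> ?A \<and> ?I (Suc k) s)"
    if k: "k < ?P" and I: "?I k (r1, h1)" for k r1 h1
  proof
    show "r1 rRun \<noteq> 0" using k I by simp
    have C1: "constants_set N (length vs) (length es) r1" and L1: "layout vs es h1"
      and M1: "\<forall>a \<ge> N. h1 a < r1 rClock" using I by (auto simp: ok_def)
    have r1: "r1 rPow = ?P" "r1 rDepth = D" "r1 rBound = m" "r1 rBudget = b"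
      "r1 rRun - 1 = ?P - Suc k"
      using I by (simp_all add: ok_def)
    have split: "(\<exists>x. ?P - Suc k \<le> x \<and> x < ?P \<and> acc x) \<longleftrightarrow>
        acc (?P - Suc k) \<or> (\<exists>x. ?P - k \<le> x \<and> x < ?P \<and> acc x)"
    proof -
      have "?P - Suc k \<le> x \<longleftrightarrow> x = ?P - Suc k \<or> ?P - k \<le> x" for x using k by arith
      then show ?thesis using k by auto
    qed
    note body = wp_run_body[OF dist C1 L1 N M1 card[unfolded E_def], folded E_def, unfolded r1,
        folded acc_def]
    show "wp run_body (r1, h1) (\<lambda>t s. t \<le> ?A \<and> ?I (Suc k) s)"
    proof (rule wp_mono[OF body], goal_cases)
      case (1 t r2 h2)
      then have "ok r2" using ok_cong[of r1 r2] I by simp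
      then show ?case using 1 I split by auto
    qed
  qed
  have loop: "wp (WhileNZ rRun run_body) s (\<lambda>t s. t \<le> ?P * (?A + 1) + 1 \<and> ?I ?P s)"
    if "?I 0 s" for s
    by (rule wp_WhileNZ[where I = ?I]) (use that step in auto)
  \<comment> \<open>Computing the depth takes about \<open>5 * m\<close> steps and the power about
    \<open>4 * D\<close>; \<open>m \<le> D\<close> merges them into \<open>9 * D\<close>.\<close>
  have mD: "m \<le> D" "D = m + m * m" by (simp_all add: D_def)
  define q :: nat where "q = (if \<exists>x < ?P. acc x then 1 else 0)"
  show ?thesis
    unfolding mmei_prog_def acc_def[symmetric] q_def[symmetric]
    using h
    apply simp
    apply (rule wp_mono)
     apply (rule wp_depth_prog)
      apply simp
     apply simp
    apply simp
    apply (rule wp_mono)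
     apply (rule wp_power_prog)
     apply simp
    apply simp
    apply (rule wp_mono)
     apply (rule loop)
    using L M apply (auto simp: ok_def constants_set_def D_def)[1]
    using mD apply (auto simp: ok_def constants_set_def q_def add.commute)
    done
qed

section \<open>Reading the encoding and bounding the total time\<close>

lemma length_concat_blocks:
  "\<forall>x\<in>set xs. length (f x) = c \<Longrightarrow> length (concat (map f xs)) = c * length xs"
  by (induction xs) auto

lemma nth_concat_blocks:
  assumes "\<forall>x\<in>set xs. length (f x) = c" "j < length xs" "i < c"
  shows "concat (map f xs) ! (c * j + i) = f (xs ! j) ! i"
  using assms
proof (induction xs arbitrary: j)
  case (Cons x xs)
  then show ?case by (cases j) (auto simp: nth_append)
qed simp

lemma layout_encoding:
  fixes es :: "(nat \<times> nat) list" and w c :: "nat set \<Rightarrow> nat"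
  defines "f \<equiv> \<lambda>(u, v). [u, v, w {u, v}, c {u, v}]"
  assumes ws: "ws = [n, e, b, m] @ vs @ concat (map f es)"
  shows "layout vs es (\<lambda>a. if a < length ws then ws ! a else 0)"
    and "length ws = 4 + length vs + 4 * length es"
proof -
  have f: "\<forall>x\<in>set es. length (f x) = 4" by (auto simp: f_def)
  note len = length_concat_blocks[OF f]
  show lws: "length ws = 4 + length vs + 4 * length es" using ws len by simp
  have off: "ws ! (4 + a) = (vs @ concat (map f es)) ! a" for a
    unfolding ws by (simp add: nth_append)
  have vs: "ws ! (4 + i) = vs ! i" if "i < length vs" for i
    unfolding off using that by (simp add: nth_append)
  have es: "ws ! (4 + length vs + 4 * j) = fst (es ! j)"
    "ws ! Suc (4 + length vs + 4 * j) = snd (es ! j)" if j: "j < length es" for j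
  proof -
    have n: "concat (map f es) ! (4 * j + i) = f (es ! j) ! i" if "i < 4" for i
      using nth_concat_blocks[OF f j that] .
    have "ws ! (4 + (length vs + (4 * j + i))) = f (es ! j) ! i" if "i < 4" for i
      unfolding off using n[OF that] by (simp add: nth_append)
    from this[of 0] this[of 1] show "ws ! (4 + length vs + 4 * j) = fst (es ! j)"
      "ws ! Suc (4 + length vs + 4 * j) = snd (es ! j)"
      by (auto simp: f_def add.assoc split: prod.splits)
  qed
  show "layout vs es (\<lambda>a. if a < length ws then ws ! a else 0)"
    unfolding layout_def lws using vs es by auto
qed

lemma length_le_input_size: "length ws \<le> input_size ws"
  by (induction ws) (auto simp: input_size_def)

text \<open>One factor \<open>2 ^ D\<close> counts the runs, the other absorbs the \<open>D\<close>
  decisions of each run. With \<open>z = s + 1\<close>, a decision costs at most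
  \<open>26 * z ^ 2\<close>, and 79 is 26 + 14 + 9 + 30. The four header cells give
  \<open>z \<ge> 5\<close>, so 79 fits into \<open>z ^ 3\<close>; hence the exponent 5.\<close>

lemma running_time_le:
  fixes n e D s :: nat
  assumes "4 + n + 4 * e \<le> s"
  shows "2 ^ D * (D * (n * (25 * e + 23) + 26) + 14) + 9 * D + 30 \<le> 2 ^ (2 * D) * (s + 1) ^ 5"
proof -
  define z where "z = s + 1"
  define W :: nat where "W = 2 ^ D"
  have DW: "D \<le> W" and W1: "1 \<le> W" unfolding W_def by (simp_all add: less_imp_le)
  have z5: "5 \<le> z" and nz: "n + 1 \<le> z" and ez: "e + 1 \<le> z" using assms by (auto simp: z_def)
  have "n * (25 * e + 23) + 26 \<le> 26 * ((n + 1) * (e + 1))" by (simp add: algebra_simps)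
  also have "\<dots> \<le> 26 * (z * z)" using mult_le_mono[OF nz ez] by simp
  finally have a: "n * (25 * e + 23) + 26 \<le> 26 * z\<^sup>2" by (simp add: power2_eq_square)
  have WW: "W \<le> W * W" "1 \<le> W * W" using W1 by simp_all
  have "W * (D * (n * (25 * e + 23) + 26) + 14) \<le> W * (W * (26 * z\<^sup>2) + 14)"
    by (intro mult_le_mono add_le_mono DW a order_refl)
  also have "\<dots> = W * W * (26 * z\<^sup>2) + 14 * W" by (simp add: algebra_simps)
  finally have "W * (D * (n * (25 * e + 23) + 26) + 14) + 9 * D + 30 \<le>
      W * W * (26 * z\<^sup>2) + 53 * (W * W)"
    using DW WW by linarith
  also have "\<dots> \<le> W * W * (79 * z\<^sup>2)"
    using z5 by (simp add: algebra_simps)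
  also have "\<dots> \<le> W * W * z ^ 5"
  proof -
    have "(5::nat) ^ 3 \<le> z ^ 3" using z5 by (rule power_mono) simp
    then have "79 \<le> z ^ 3" by simp
    then have "79 * z\<^sup>2 \<le> z ^ 3 * z\<^sup>2" by (rule mult_le_mono1)
    then show ?thesis by (simp flip: power_add)
  qed
  finally show ?thesis by (simp add: W_def z_def mult_2 power_add)
qed

theorem theorem4:
  shows "fixed_parameter_tractable mmei_encodes unit_bipartite_mmei mmei_yes bound"
  unfolding fixed_parameter_tractable_def
proof (intro exI conjI ballI allI impI)
  show "computable (\<lambda>k. 2 ^ (2 * (k * (k + 1))))" by (rule computable_bound)
  fix x ws assume x: "x \<in> unit_bipartite_mmei" and "mmei_encodes x ws"
  let ?S = "\<lambda>(u, v). {u, v}"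
  obtain vs es where vs: "set vs = verts x"
    and dist: "distinct (map ?S es)" and E: "set (map ?S es) = edges x"
    and ws: "ws = [length vs, length es, budget x, bound x] @ vs @
      concat (map (\<lambda>(u, v). [u, v, weight x {u, v}, cost x {u, v}]) es)"
    using \<open>mmei_encodes x ws\<close> unfolding mmei_encodes_def by blast
  obtain A B where AB: "A \<union> B = verts x" "A \<inter> B = {}"
    and bip: "\<forall>e\<in>edges x. \<exists>a\<in>A. \<exists>b\<in>B. e = {a, b}"
    using x by (auto simp: unit_bipartite_mmei_def bipartite_def)
  let ?D = "bound x * (bound x + 1)"
  let ?h = "\<lambda>a. if a < length ws then ws ! a else 0"
  note enc = layout_encoding[OF ws]
  have fin: "finite (edges x)" unfolding E[symmetric] by simp
  have "\<forall>e\<in>edges x. e \<subseteq> set vs" using bip AB(1) vs by fastforce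
  then have yes: "(\<exists>y < 2 ^ ?D. card (uncovered (edges x) (fst (fold (branch vs (edges x))
      (digits (2 ^ ?D) ?D y) ({}, {}, bound x)))) \<le> budget x) \<longleftrightarrow> mmei_yes x"
    unfolding unit_bipartite_mmei_yes_iff[OF x]
    by (intro search_correct[OF AB(2) bip]) (use vs AB(1) fin in simp_all)
  have "4 + length vs + 4 * length es \<le> input_size ws"
    using length_le_input_size[of ws] enc(2) by simp
  note time = running_time_le[OF this, of ?D]
  have "wp mmei_prog ((\<lambda>_. 0)(0 := length ws), ?h) (\<lambda>t s.
    t \<le> 2 ^ ?D * (?D * (length vs * (25 * length es + 23) + 26) + 14) + 9 * ?D + 30 \<and>
    fst s 0 = (if mmei_yes x then 1 else 0))"
    unfolding yes[symmetric] E[symmetric]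
    by (rule wp_mmei_prog[OF dist enc(1)]) (use enc(2) in \<open>auto simp: ws\<close>)
  then show "computes_within mmei_prog ws
      (2 ^ (2 * ?D) * (input_size ws + 1) ^ 5) (if mmei_yes x then 1 else 0)"
    unfolding initial_config_def[symmetric]
    by (intro computes_withinI, elim wp_mono) (use time in auto)
qed

end
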